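(* Let $K$ be a field of characteristic zero, let $\lambda$ be a partition of $r$ and let $\mu=(\mu_1,\dots,\mu_\ell)=\lambda'$ be its conjugate partition. (1) Suppose $\ell=2$ and $k$ is a positive integer with $k\le\mu_2$. Then $M^\lambda/GR^\lambda(k)\cong S^\lambda$ as $\mathfrak{S}_r$-modules if and only if $\mu_1>k$ or $\mu_1=\mu_2=k=1$. (2) Suppose $k_1,\dots,k_{\ell-1}$ are positive integers with $k_c\le\mu_{c+1}$ for $c=1,\dots,\ell-1$. If $\mu_c>\mu_{c+1}$ for every $c$ such that $k_c=\mu_{c+1}>1$, then $M^\lambda/GR^\lambda(k_1,\dots,k_{\ell-1})\cong S^\lambda$ as $\mathfrak{S}_r$-modules.
   Context: For a partition $\lambda$ of $r$, $\lambda'$ denotes its conjugate, so $\lambda'_c$ is the length of the $c$-th column of the Young diagram of $\lambda$; the number of columns is $\ell=\lambda_1$. A Young tableau of shape $\lambda$ is a filling of the Young diagram of $\lambda$ using each of $1,\dots,r$ exactly once. $M^{\lambda}$ is the $K$-vector space generated by all Young tableaux of shape $\lambda$ subject to the relations $T+S=0$ whenever $S$ is obtained from $T$ by transposing two entries in the same column; $\overline{T}$ denotes the image of $T$. $\mathfrak{S}_r$ acts by replacing each entry $i$ by $\sigma(i)$. $S^\lambda$ denotes the Specht module indexed by $\lambda$. For a tableau $T$, a column $c\le \ell-1$ and $k_c\le\lambda'_{c+1}$, the Garnir relation is $g^{T}_{c,k_c}=\overline{T}-\sum\overline{S}$, where the sum is over all tableaux $S$ obtained from $T$ by exchanging the top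 $k_c$ entries of column $c+1$ with any $k_c$ entries of column $c$, placing each exchanged set into the positions vacated by the other while maintaining the top-to-bottom order within each exchanged set. $GR^{\lambda}(k_1,\dots,k_{\ell-1})$ is the subspace of $M^\lambda$ spanned by all $g^{T}_{c,k_c}$, $T$ a tableau of shape $\lambda$, $1\le c\le\ell-1$ (for $\ell=2$ this is written $GR^\lambda(k)$). *)

theory Defs
  imports "HOL-Combinatorics.Permutations"
begin

(* Partitions are nonincreasing lists of positive naturals; rows and columns are 0-indexed. *)

definition is_partition :: "nat list \<Rightarrow> nat \<Rightarrow> bool" where
  "is_partition ls r \<longleftrightarrow> sorted_wrt (\<ge>) ls \<and> (\<forall>x\<in>set ls. 0 < x) \<and> sum_list ls = r"

definition conj_part :: "nat list \<Rightarrow> nat list" where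
  "conj_part ls = map (\<lambda>c. length (filter (\<lambda>x. c < x) ls)) [0..<(if ls = [] then 0 else hd ls)]"

definition young_diagram :: "nat list \<Rightarrow> (nat \<times> nat) set" where
  "young_diagram ls = {(i, j). i < length ls \<and> j < ls ! i}"

type_synonym tableau = "nat \<times> nat \<Rightarrow> nat"

definition tableaux :: "nat list \<Rightarrow> tableau set" where
  "tableaux ls = {T. bij_betw T (young_diagram ls) {1..sum_list ls}
                    \<and> (\<forall>x. x \<notin> young_diagram ls \<longrightarrow> T x = 0)}"

definition delta :: "'a \<Rightarrow> 'a \<Rightarrow> 'k::zero_neq_one" where
  "delta a = (\<lambda>b. if b = a then 1 else 0)"

definition lin_span :: "('a \<Rightarrow> 'k::comm_ring_1) set \<Rightarrow> ('a \<Rightarrow> 'k) set" where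
  "lin_span S = {f. \<exists>A c. finite A \<and> A \<subseteq> S \<and> f = (\<lambda>x. \<Sum>v\<in>A. c v * v x)}"

definition free_space :: "nat list \<Rightarrow> (tableau \<Rightarrow> 'k::comm_ring_1) set" where
  "free_space ls = {f. \<forall>T. T \<notin> tableaux ls \<longrightarrow> f T = 0}"

definition column_relations :: "nat list \<Rightarrow> (tableau \<Rightarrow> 'k::comm_ring_1) set" where
  "column_relations ls = {(\<lambda>U. delta T U + delta S U) | T S. T \<in> tableaux ls \<and>
     (\<exists>i1 i2 j. (i1, j) \<in> young_diagram ls \<and> (i2, j) \<in> young_diagram ls \<and> i1 \<noteq> i2
        \<and> S = T((i1, j) := T (i2, j), (i2, j) := T (i1, j)))}"

definition garnir_exchange :: "tableau \<Rightarrow> nat \<Rightarrow> nat set \<Rightarrow> tableau" where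
  "garnir_exchange T c A = (\<lambda>(i, j).
     if j = c \<and> i \<in> A then T (card {a\<in>A. a < i}, Suc c)
     else if j = Suc c \<and> i < card A then T (sorted_list_of_set A ! i, c)
     else T (i, j))"

definition garnir_element :: "nat list \<Rightarrow> tableau \<Rightarrow> nat \<Rightarrow> nat \<Rightarrow> (tableau \<Rightarrow> 'k::comm_ring_1)" where
  "garnir_element ls T c k = (\<lambda>U. delta T U -
     (\<Sum>A\<in>{A. A \<subseteq> {0..<conj_part ls ! c} \<and> card A = k}. delta (garnir_exchange T c A) U))"

(* lifts to the free space of the generators of GR(k_1,...,k_{l-1}); ks ! c is k_{c+1} *)
definition garnir_relations :: "nat list \<Rightarrow> nat list \<Rightarrow> (tableau \<Rightarrow> 'k::comm_ring_1) set" where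
  "garnir_relations ls ks = {garnir_element ls T c (ks ! c) | T c.
      T \<in> tableaux ls \<and> Suc c < length (conj_part ls)}"

definition tabloid :: "nat list \<Rightarrow> tableau \<Rightarrow> (nat \<times> nat) set" where
  "tabloid ls T = {(T (i, j), i) | i j. (i, j) \<in> young_diagram ls}"

definition col_stab :: "nat list \<Rightarrow> tableau \<Rightarrow> (nat \<Rightarrow> nat) set" where
  "col_stab ls T = {\<sigma>. \<sigma> permutes {1..sum_list ls} \<and>
     (\<forall>(i, j)\<in>young_diagram ls. \<exists>i'. (i', j) \<in> young_diagram ls \<and> \<sigma> (T (i, j)) = T (i', j))}"

definition polytabloid :: "nat list \<Rightarrow> tableau \<Rightarrow> ((nat \<times> nat) set \<Rightarrow> 'k::comm_ring_1)" where
  "polytabloid ls T = (\<lambda>\<tau>. \<Sum>\<sigma>\<in>col_stab ls T. of_int (sign \<sigma>) * delta (tabloid ls (\<sigma> \<circ> T)) \<tau>)"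

definition specht_module :: "nat list \<Rightarrow> ((nat \<times> nat) set \<Rightarrow> 'k::comm_ring_1) set" where
  "specht_module ls = lin_span {polytabloid ls T | T. T \<in> tableaux ls}"

(* actions of a permutation sigma: T \<mapsto> sigma \<circ> T, {T} \<mapsto> {sigma \<circ> T} *)
definition act_tab :: "(nat \<Rightarrow> nat) \<Rightarrow> (tableau \<Rightarrow> 'k) \<Rightarrow> (tableau \<Rightarrow> 'k)" where
  "act_tab \<sigma> f = (\<lambda>T. f (inv \<sigma> \<circ> T))"

definition act_tabloid :: "(nat \<Rightarrow> nat) \<Rightarrow> ((nat \<times> nat) set \<Rightarrow> 'k) \<Rightarrow> ((nat \<times> nat) set \<Rightarrow> 'k)" where
  "act_tabloid \<sigma> g = (\<lambda>\<tau>. g (map_prod (inv \<sigma>) id ` \<tau>))"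

(* M^lambda / GR^lambda(ks) is isomorphic to S^lambda as S_r-modules:
   M^lambda / GR = F / (column relations + lifted Garnir relations), and an isomorphism
   of this quotient onto S^lambda is the same as a surjective equivariant linear map
   F \<rightarrow> S^lambda with exactly that kernel. *)
definition garnir_quotient_iso_specht :: "'k::field itself \<Rightarrow> nat list \<Rightarrow> nat list \<Rightarrow> bool" where
  "garnir_quotient_iso_specht t ls ks \<longleftrightarrow>
    (\<exists>\<phi> :: (tableau \<Rightarrow> 'k) \<Rightarrow> ((nat \<times> nat) set \<Rightarrow> 'k).
       (\<forall>f\<in>free_space ls. \<forall>g\<in>free_space ls. \<phi> (\<lambda>T. f T + g T) = (\<lambda>\<tau>. \<phi> f \<tau> + \<phi> g \<tau>)) \<and>
       (\<forall>a. \<forall>f\<in>free_space ls. \<phi> (\<lambda>T. a * f T) = (\<lambda>\<tau>. a * \<phi> f \<tau>)) \<and>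
       \<phi> ` free_space ls = specht_module ls \<and>
       {f \<in> free_space ls. \<phi> f = (\<lambda>_. 0)} = lin_span (column_relations ls \<union> garnir_relations ls ks) \<and>
       (\<forall>\<sigma>. \<sigma> permutes {1..sum_list ls} \<longrightarrow>
          (\<forall>f\<in>free_space ls. \<phi> (act_tab \<sigma> f) = act_tabloid \<sigma> (\<phi> f))))"

end

theory Submission
  imports Defs "HOL-Library.Function_Algebras" Complex_Main
begin

text \<open>
  A linear functional on \<open>M\<^sup>\<lambda>\<close> is a function \<open>a\<close> on tableaux that changes sign under column swaps.
  Multiplied by the sign of the tableau it depends only on the column sets, and for two adjacent
  columns it becomes a function \<open>h\<close> on the \<open>m\<close>-subsets of an \<open>(n + m)\<close>-set. The Garnir relations with
  parameter \<open>k\<close> say that certain restrictions of \<open>h\<close> are eigenfunctions of a Kneser graph on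
  \<open>k\<close>-subsets of an \<open>(n + k)\<close>-set with eigenvalue \<open>(-1)\<^sup>k\<close>. If \<open>k < n\<close>, this eigenvalue occurs only on
  the eigenspace where all sums over the \<open>k\<close>-sets containing a given \<open>(k - 1)\<close>-set vanish, and then
  the sums of \<open>h\<close> over the one-point extensions of an \<open>(m - 1)\<close>-set vanish. This condition does not
  involve \<open>k\<close>, so one \<open>k\<close> yields the Garnir relations for all \<open>k\<close>, and classical straightening
  together with the independence of the standard polytabloids gives the isomorphism. If
  \<open>k = n = m > 1\<close>, the relations only identify a tableau with the exchange of its two columns, which
  leaves a quotient strictly larger than the Specht module.
\<close>

section \<open>Functions on subsets of fixed size\<close>

text \<open>The numerical conditions come from comparing absolute values and parities. For k < n and
  i < k the binomial coefficient n - i choose k - i exceeds 1, so in characteristic zero it can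
  never be a sign. For k = n every eigenvalue is just (-1)^i, and i = k - 2 collides with i = k as
  soon as k is at least 2; for k = n = 1 only 1 and -1 occur, so that case survives. As k_c is at
  most mu_{c+1}, which is at most mu_c, the excluded case is exactly k_c = mu_{c+1} = mu_c > 1. No
  eigenspaces are constructed. The sums over all k-sets containing R, taken by increasing size of R,
  satisfy a triangular system by inclusion-exclusion, and its diagonal entries are 1 minus a signed
  binomial coefficient. Working with functionals replaces spans by pointwise equations. Statements
  about spans are recovered by duality, since everything is supported on the finite set of tableaux.
  For the negative result this does not suffice: a hypothetical isomorphism is an arbitrary map, not
  the one sending tableaux to polytabloids, so dimensions have to be compared.\<close>

lemma alternating_sum_Pow:
  assumes "finite A"
  shows "(\<Sum>S\<in>Pow A. (-1) ^ card S) = (if A = {} then 1 else 0 :: 'k::comm_ring_1)"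
  using assms
proof (induction A rule: finite_induct)
  case (insert x A)
  have inj: "inj_on (insert x) (Pow A)"
    using insert.hyps by (auto simp: inj_on_def)
  have "(\<Sum>S\<in>Pow (insert x A). (-1) ^ card S) =
        (\<Sum>S\<in>Pow A. (-1) ^ card S) + (\<Sum>S\<in>insert x ` Pow A. (-1) ^ card S :: 'k)"
    unfolding Pow_insert using insert.hyps by (intro sum.union_disjoint) auto
  also have "(\<Sum>S\<in>insert x ` Pow A. (-1) ^ card S) = (\<Sum>S\<in>Pow A. (-1) ^ Suc (card S) :: 'k)"
    unfolding sum.reindex[OF inj] comp_def
  proof (rule sum.cong)
    fix S assume "S \<in> Pow A"
    then have "finite S" "x \<notin> S"
      using insert.hyps finite_subset by auto
    then show "(-1) ^ card (insert x S) = (-1 :: 'k) ^ Suc (card S)"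
      by simp
  qed simp
  finally show ?case
    by (simp add: sum_negf)
qed simp

text \<open>After exchanging the sums, a fixed Q is weighted by the alternating sum over the subsets
  of \<open>Q \<inter> R\<close>, which vanishes unless that intersection is empty.\<close>

lemma sum_disjoint_inclusion_exclusion:
  fixes f :: "'a set \<Rightarrow> 'k::comm_ring_1"
  assumes "finite N" "finite R"
  shows "(\<Sum>Q\<in>{Q \<in> N. Q \<inter> R = {}}. f Q) =
         (\<Sum>S\<in>Pow R. (-1) ^ card S * (\<Sum>Q\<in>{Q \<in> N. S \<subseteq> Q}. f Q))"
proof -
  have "(\<Sum>S\<in>Pow R. (-1) ^ card S * (\<Sum>Q\<in>{Q \<in> N. S \<subseteq> Q}. f Q)) =
        (\<Sum>S\<in>Pow R. \<Sum>Q\<in>N. if S \<subseteq> Q then (-1) ^ card S * f Q else 0)"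
    by (simp add: sum_distrib_left sum.inter_filter[OF assms(1)] if_distrib cong: if_cong)
  also have "\<dots> = (\<Sum>Q\<in>N. \<Sum>S\<in>Pow R. if S \<subseteq> Q then (-1) ^ card S * f Q else 0)"
    by (rule sum.swap)
  also have "\<dots> = (\<Sum>Q\<in>N. if Q \<inter> R = {} then f Q else 0)"
  proof (rule sum.cong)
    fix Q assume "Q \<in> N"
    have "(\<Sum>S\<in>Pow R. if S \<subseteq> Q then (-1) ^ card S * f Q else 0) =
          (\<Sum>S\<in>{S \<in> Pow R. S \<subseteq> Q}. (-1) ^ card S * f Q)"
      using assms(2) by (intro sum.inter_filter[symmetric]) simp
    also have "{S \<in> Pow R. S \<subseteq> Q} = Pow (Q \<inter> R)" by auto
    also have "(\<Sum>S\<in>Pow (Q \<inter> R). (-1) ^ card S * f Q) =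
          (\<Sum>S\<in>Pow (Q \<inter> R). (-1) ^ card S) * f Q"
      by (rule sum_distrib_right[symmetric])
    also have "(\<Sum>S\<in>Pow (Q \<inter> R). (-1) ^ card S) = (if Q \<inter> R = {} then 1 else 0 :: 'k)"
      using assms(2) by (intro alternating_sum_Pow) simp
    finally show "(\<Sum>S\<in>Pow R. if S \<subseteq> Q then (-1) ^ card S * f Q else 0) =
               (if Q \<inter> R = {} then f Q else 0)"
      by simp
  qed simp
  finally show ?thesis
    by (simp add: sum.inter_filter[OF assms(1)])
qed

text \<open>Strictness is the point: a number above 1 is not a sign, which rules out the eigenvalues
  with i < k.\<close>

lemma binomial_gt_1:
  assumes "0 < b" "b < a"
  shows "1 < a choose b"
  using assms
proof (induction a arbitrary: b)
  case (Suc a)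
  obtain c where b: "b = Suc c" using Suc.prems gr0_conv_Suc by auto
  have "0 < a choose c" "0 < a choose Suc c"
    using Suc.prems b by (auto simp: zero_less_binomial_iff)
  then have "1 < (a choose c) + (a choose Suc c)" by linarith
  then show ?case by (simp add: b)
qed simp

text \<open>On the \<open>k\<close>-subsets of an \<open>(n + k)\<close>-set the disjointness (Kneser graph) operator has the
  eigenvalues \<open>(-1) ^ i * (n - i choose k - i)\<close>; for \<open>k < n\<close> only \<open>i = k\<close> gives \<open>(-1) ^ k\<close>.
  The sums below detect the components in the eigenspaces with \<open>i < k\<close>.\<close>
lemma kneser_superset_sum_zero:
  fixes f :: "'a set \<Rightarrow> 'k::field_char_0"
  assumes D: "finite D" "card D = n + k" and kn: "k < n"
    and f: "\<And>P. P \<subseteq> D \<Longrightarrow> card P = k \<Longrightarrow>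
              f P = (-1) ^ k * (\<Sum>Q\<in>{Q. Q \<subseteq> D - P \<and> card Q = k}. f Q)"
    and R: "R \<subseteq> D" "card R < k"
  shows "(\<Sum>P\<in>{P. P \<subseteq> D \<and> card P = k \<and> R \<subseteq> P}. f P) = 0"
  using R
proof (induction "card R" arbitrary: R rule: less_induct)
  case less
  define N where "N = {P. P \<subseteq> D \<and> card P = k}"
  define F where "F R = (\<Sum>P\<in>{P \<in> N. R \<subseteq> P}. f P)" for R
  have FN: "finite N" unfolding N_def using D(1) by auto
  have finR: "finite R" using less.prems D(1) finite_subset by blast
  let ?i = "card R"
  \<comment> \<open>Such a P is R together with k - i points of D - Q - R, and this set has (n + k)
    - k - i = n - i points.\<close>
  have cnt: "card {P \<in> N. R \<subseteq> P \<and> Q \<inter> P = {}} = (n - ?i) choose (k - ?i)"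
    if Q: "Q \<in> N" "Q \<inter> R = {}" for Q
  proof -
    have finQ: "finite Q" using Q D(1) finite_subset unfolding N_def by auto
    have "bij_betw (\<lambda>P. P \<union> R) {P. P \<subseteq> D - Q - R \<and> card P = k - ?i}
            {P \<in> N. R \<subseteq> P \<and> Q \<inter> P = {}}"
    proof (rule bij_betw_byWitness[where f' = "\<lambda>P. P - R"])
      show "(\<lambda>P. P \<union> R) ` {P. P \<subseteq> D - Q - R \<and> card P = k - card R}
              \<subseteq> {P \<in> N. R \<subseteq> P \<and> Q \<inter> P = {}}"
      proof (clarsimp, intro conjI)
        fix P assume P: "P \<subseteq> D - Q - R" "card P = k - card R"
        have "finite P" using P D(1) finite_subset by (metis finite_Diff)
        then have "card (P \<union> R) = k"
          using P less.prems finR by (subst card_Un_disjoint) auto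
        then show "P \<union> R \<in> N" unfolding N_def using P less.prems by auto
        show "Q \<inter> (P \<union> R) = {}" using P Q by auto
      qed
      show "(\<lambda>P. P - R) ` {P \<in> N. R \<subseteq> P \<and> Q \<inter> P = {}}
              \<subseteq> {P. P \<subseteq> D - Q - R \<and> card P = k - card R}"
      proof
        fix X assume "X \<in> (\<lambda>P. P - R) ` {P \<in> N. R \<subseteq> P \<and> Q \<inter> P = {}}"
        then obtain P where P: "X = P - R" "P \<subseteq> D" "card P = k" "R \<subseteq> P" "Q \<inter> P = {}"
          unfolding N_def by blast
        then have "X \<subseteq> D - Q - R" by blast
        moreover have "card X = k - ?i" using P finR by (simp add: card_Diff_subset)
        ultimately show "X \<in> {P. P \<subseteq> D - Q - R \<and> card P = k - ?i}" by blast
      qed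
    qed blast+
    then have "card {P \<in> N. R \<subseteq> P \<and> Q \<inter> P = {}} = card {P. P \<subseteq> D - Q - R \<and> card P = k - ?i}"
      by (rule bij_betw_same_card[symmetric])
    also have "\<dots> = card (D - Q - R) choose (k - ?i)"
      using D(1) by (simp add: n_subsets)
    also have "card (D - Q - R) = n - ?i"
    proof -
      have "card (D - Q) = n"
        using Q finQ D by (simp add: card_Diff_subset N_def)
      moreover have "R \<subseteq> D - Q" using Q less.prems by auto
      ultimately show ?thesis using finR by (simp add: card_Diff_subset)
    qed
    finally show ?thesis .
  qed
  \<comment> \<open>Sum the eigenvalue equation over all P containing R. After exchanging the sums,
    a set Q counts only if it misses R, and then always with the multiplicity found in
    \<open>cnt\<close>.\<close>
  have "F R = (\<Sum>P\<in>{P \<in> N. R \<subseteq> P}. (-1) ^ k * (\<Sum>Q\<in>{Q \<in> N. Q \<inter> P = {}}. f Q))"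
    unfolding F_def
  proof (rule sum.cong)
    fix P assume "P \<in> {P \<in> N. R \<subseteq> P}"
    then have "f P = (-1) ^ k * (\<Sum>Q\<in>{Q. Q \<subseteq> D - P \<and> card Q = k}. f Q)"
      using f by (auto simp: N_def)
    moreover have "{Q. Q \<subseteq> D - P \<and> card Q = k} = {Q \<in> N. Q \<inter> P = {}}"
      by (auto simp: N_def)
    ultimately show "f P = (-1) ^ k * (\<Sum>Q\<in>{Q \<in> N. Q \<inter> P = {}}. f Q)"
      by simp
  qed simp
  also have "\<dots> = (-1) ^ k * (\<Sum>P\<in>{P \<in> N. R \<subseteq> P}. \<Sum>Q\<in>{Q \<in> N. Q \<inter> P = {}}. f Q)"
    by (simp add: sum_distrib_left)
  also have "(\<Sum>P\<in>{P \<in> N. R \<subseteq> P}. \<Sum>Q\<in>{Q \<in> N. Q \<inter> P = {}}. f Q) =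
      (\<Sum>Q\<in>N. \<Sum>P\<in>{P \<in> {P \<in> N. R \<subseteq> P}. Q \<inter> P = {}}. f Q)"
    using FN by (intro sum.swap_restrict) auto
  also have "\<dots> = (\<Sum>Q\<in>N. if Q \<inter> R = {} then of_nat ((n - ?i) choose (k - ?i)) * f Q else 0)"
  proof (rule sum.cong)
    fix Q assume Q: "Q \<in> N"
    show "(\<Sum>P\<in>{P \<in> {P \<in> N. R \<subseteq> P}. Q \<inter> P = {}}. f Q) =
      (if Q \<inter> R = {} then of_nat ((n - ?i) choose (k - ?i)) * f Q else 0)"
    proof (cases "Q \<inter> R = {}")
      case True
      then show ?thesis using cnt[OF Q True] by simp
    next
      case False
      then have "{P \<in> {P \<in> N. R \<subseteq> P}. Q \<inter> P = {}} = {}" by auto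
      then show ?thesis using False by (simp only: sum.empty if_False)
    qed
  qed simp
  also have "\<dots> = of_nat ((n - ?i) choose (k - ?i)) * (\<Sum>Q\<in>{Q \<in> N. Q \<inter> R = {}}. f Q)"
    by (simp add: sum.inter_filter[OF FN] sum_distrib_left if_distrib cong: if_cong)
  \<comment> \<open>Inclusion-exclusion leads back to the sums F S for S inside R. The induction
    hypothesis removes all proper subsets, leaving a scalar multiple of F R.\<close>
  also have "(\<Sum>Q\<in>{Q \<in> N. Q \<inter> R = {}}. f Q) = (\<Sum>S\<in>Pow R. (-1) ^ card S * F S)"
    unfolding F_def by (rule sum_disjoint_inclusion_exclusion[OF FN finR])
  also have "\<dots> = (\<Sum>S\<in>{R}. (-1) ^ card S * F S)"
  proof (rule sum.mono_neutral_right)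
    show "\<forall>S\<in>Pow R - {R}. (- 1) ^ card S * F S = 0"
    proof
      fix S assume "S \<in> Pow R - {R}"
      then have S: "S \<subset> R" by auto
      then have "card S < card R" using finR psubset_card_mono by blast
      then have "(\<Sum>P\<in>{P. P \<subseteq> D \<and> card P = k \<and> S \<subseteq> P}. f P) = 0"
        using less.hyps[of S] less.prems S by auto
      then show "(- 1) ^ card S * F S = 0"
        by (simp add: F_def N_def conj_assoc)
    qed
  qed (use finR in auto)
  finally have eq: "F R * (1 - (-1) ^ k * of_nat ((n - ?i) choose (k - ?i)) * (-1) ^ ?i) = 0"
    by (simp add: algebra_simps)
  have "1 < (n - ?i) choose (k - ?i)"
    using less.prems kn by (intro binomial_gt_1) auto
  \<comment> \<open>Squaring removes the sign, whatever its parity, and characteristic zero brings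
    the equation back to natural numbers.\<close>
  moreover have "(-1) ^ k * of_nat c * (-1) ^ ?i \<noteq> (1 :: 'k)" if "1 < c" for c :: nat
  proof
    assume "(-1) ^ k * of_nat c * (-1) ^ ?i = (1 :: 'k)"
    then have "((-1) ^ k * of_nat c * (-1) ^ ?i) ^ 2 = (1 :: 'k)" by simp
    then have "of_nat c ^ 2 = (1 :: 'k)"
      by (simp add: power_mult_distrib flip: power_mult)
    then have "of_nat (c ^ 2) = (of_nat 1 :: 'k)" by simp
    then have "c ^ 2 = 1" by (metis of_nat_eq_iff)
    then show False using that by (simp add: power2_eq_square)
  qed
  ultimately have "F R = 0"
    using eq by (metis eq_iff_diff_eq_0 mult_eq_0_iff)
  then show ?case by (simp add: F_def N_def conj_assoc)
qed

text \<open>Double counting: add up the vanishing sums for R with one further point y over all y.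
  Each P above R appears once for each of its k - |R| remaining points, and this factor is
  invertible in characteristic zero. The induction runs downwards from |R| = k - 1.\<close>

lemma superset_sum_zero_descend:
  fixes f :: "'a set \<Rightarrow> 'k::field_char_0"
  assumes D: "finite D" and "0 < k"
    and f: "\<And>R. R \<subseteq> D \<Longrightarrow> card R = k - 1 \<Longrightarrow>
              (\<Sum>P\<in>{P. P \<subseteq> D \<and> card P = k \<and> R \<subseteq> P}. f P) = 0"
    and R: "R \<subseteq> D" "card R < k"
  shows "(\<Sum>P\<in>{P. P \<subseteq> D \<and> card P = k \<and> R \<subseteq> P}. f P) = 0"
  using R
proof (induction "k - card R" arbitrary: R rule: less_induct)
  case less
  define N where "N = {P. P \<subseteq> D \<and> card P = k}"
  have FN: "finite N" unfolding N_def using D by auto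
  have finR: "finite R" using less.prems D finite_subset by blast
  show ?case
  proof (cases "card R = k - 1")
    case True
    then show ?thesis using f less.prems by auto
  next
    case False
    have "(\<Sum>y\<in>D - R. \<Sum>P\<in>{P. P \<subseteq> D \<and> card P = k \<and> insert y R \<subseteq> P}. f P) = 0"
    proof (rule sum.neutral, rule ballI)
      fix y assume "y \<in> D - R"
      then show "(\<Sum>P\<in>{P. P \<subseteq> D \<and> card P = k \<and> insert y R \<subseteq> P}. f P) = 0"
        using less.prems False finR by (intro less.hyps) auto
    qed
    also have "(\<Sum>y\<in>D - R. \<Sum>P\<in>{P. P \<subseteq> D \<and> card P = k \<and> insert y R \<subseteq> P}. f P) =
       (\<Sum>y\<in>D - R. \<Sum>P\<in>{P \<in> {P\<in>N. R \<subseteq> P}. y \<in> P}. f P)"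
      by (intro sum.cong) (auto simp: N_def)
    also have "\<dots> = (\<Sum>P\<in>{P\<in>N. R \<subseteq> P}. \<Sum>y\<in>{y \<in> D - R. y \<in> P}. f P)"
      using FN D by (intro sum.swap_restrict) auto
    also have "\<dots> = (\<Sum>P\<in>{P\<in>N. R \<subseteq> P}. of_nat (k - card R) * f P)"
    proof (rule sum.cong)
      fix P assume P: "P \<in> {P\<in>N. R \<subseteq> P}"
      then have "{y \<in> D - R. y \<in> P} = P - R" by (auto simp: N_def)
      moreover have "card (P - R) = k - card R"
        using P finR by (simp add: card_Diff_subset N_def)
      ultimately show "(\<Sum>y\<in>{y \<in> D - R. y \<in> P}. f P) = of_nat (k - card R) * f P" by simp
    qed simp
    also have "\<dots> = of_nat (k - card R) * (\<Sum>P\<in>{P\<in>N. R \<subseteq> P}. f P)"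
      by (simp add: sum_distrib_left)
    finally have "of_nat (k - card R) * (\<Sum>P\<in>{P\<in>N. R \<subseteq> P}. f P) = 0" by simp
    then show ?thesis using less.prems by (simp add: N_def conj_assoc)
  qed
qed

text \<open>The converse of \<open>kneser_superset_sum_zero\<close>, for every positive k; this is
  what lets one Garnir parameter imply the others. When disjointness from P is expanded by
  inclusion-exclusion, only S = P contributes, and its only k-element superset is P itself.\<close>

lemma kneser_relation:
  fixes f :: "'a set \<Rightarrow> 'k::field_char_0"
  assumes D: "finite D" and "0 < k"
    and f: "\<And>R. R \<subseteq> D \<Longrightarrow> card R = k - 1 \<Longrightarrow>
              (\<Sum>P\<in>{P. P \<subseteq> D \<and> card P = k \<and> R \<subseteq> P}. f P) = 0"
    and P: "P \<subseteq> D" "card P = k"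
  shows "f P = (-1) ^ k * (\<Sum>Q\<in>{Q. Q \<subseteq> D - P \<and> card Q = k}. f Q)"
proof -
  define N where "N = {P. P \<subseteq> D \<and> card P = k}"
  have FN: "finite N" unfolding N_def using D by auto
  have finP: "finite P" using P D finite_subset by blast
  have "{Q. Q \<subseteq> D - P \<and> card Q = k} = {Q\<in>N. Q \<inter> P = {}}" by (auto simp: N_def)
  then have "(\<Sum>Q\<in>{Q. Q \<subseteq> D - P \<and> card Q = k}. f Q) =
     (\<Sum>S\<in>Pow P. (-1) ^ card S * (\<Sum>Q\<in>{Q \<in> N. S \<subseteq> Q}. f Q))"
    using sum_disjoint_inclusion_exclusion[OF FN finP] by simp
  also have "\<dots> = (\<Sum>S\<in>{P}. (-1) ^ card S * (\<Sum>Q\<in>{Q \<in> N. S \<subseteq> Q}. f Q))"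
  proof (rule sum.mono_neutral_right)
    show "\<forall>S\<in>Pow P - {P}. (-1) ^ card S * (\<Sum>Q\<in>{Q \<in> N. S \<subseteq> Q}. f Q) = 0"
    proof
      fix S assume "S \<in> Pow P - {P}"
      then have S: "S \<subset> P" by auto
      then have "card S < k" using finP P psubset_card_mono by blast
      then have "(\<Sum>P\<in>{P. P \<subseteq> D \<and> card P = k \<and> S \<subseteq> P}. f P) = 0"
        using superset_sum_zero_descend[OF D \<open>0 < k\<close> f] S P by auto
      then show "(- 1) ^ card S * (\<Sum>Q\<in>{Q \<in> N. S \<subseteq> Q}. f Q) = 0"
        by (simp add: N_def conj_assoc)
    qed
  qed (use finP in auto)
  also have "\<dots> = (-1) ^ k * f P"
  proof -
    have "Q = P" if "Q \<in> N" "P \<subseteq> Q" for Q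
      using that P D by (metis (mono_tags, lifting) N_def card_subset_eq finite_subset mem_Collect_eq)
    then have "{Q \<in> N. P \<subseteq> Q} = {P}" using P by (auto simp: N_def)
    then show ?thesis using P by simp
  qed
  finally show ?thesis by (simp flip: power_add mult.assoc)
qed

text \<open>Here E is the union of two adjacent columns, B the right one, P the part of B that
  leaves and Q the part that enters. The sign is that of k transpositions, because h is twisted by
  the sign of the tableau.\<close>

definition exchange_relation :: "'a set \<Rightarrow> nat \<Rightarrow> nat \<Rightarrow> ('a set \<Rightarrow> 'k::comm_ring_1) \<Rightarrow> bool" where
  "exchange_relation E m k h \<longleftrightarrow> (\<forall>B P. B \<subseteq> E \<longrightarrow> card B = m \<longrightarrow> P \<subseteq> B \<longrightarrow> card P = k \<longrightarrow>
     h B = (-1) ^ k * (\<Sum>Q\<in>{Q. Q \<subseteq> E - B \<and> card Q = k}. h (B - P \<union> Q)))"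

text \<open>This is the kernel of the map that sums a function on m-subsets up to one on (m -
  1)-subsets. If E has n + m points with m \<le> n, it is in characteristic zero the Specht module
  of shape (n, m). Writing \<open>Suc (card R) = m\<close> makes the condition vacuous for m =
  0.\<close>

definition extension_sums_zero :: "'a set \<Rightarrow> nat \<Rightarrow> ('a set \<Rightarrow> 'k::comm_ring_1) \<Rightarrow> bool" where
  "extension_sums_zero E m h \<longleftrightarrow>
     (\<forall>R. R \<subseteq> E \<longrightarrow> Suc (card R) = m \<longrightarrow> (\<Sum>y\<in>E - R. h (insert y R)) = 0)"

lemma sum_singletons:
  fixes g :: "'a set \<Rightarrow> 'k::comm_monoid_add"
  assumes "0 < k" "R \<subseteq> D" "card R = k - 1" "finite D"
  shows "(\<Sum>P\<in>{P. P \<subseteq> D \<and> card P = k \<and> R \<subseteq> P}. g P) = (\<Sum>y\<in>D - R. g (insert y R))"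
proof (rule sum.reindex_bij_betw[symmetric])
  have finR: "finite R" using assms finite_subset by blast
  show "bij_betw (\<lambda>y. insert y R) (D - R) {P. P \<subseteq> D \<and> card P = k \<and> R \<subseteq> P}"
    unfolding bij_betw_def
  proof
    show "inj_on (\<lambda>y. insert y R) (D - R)" by (auto simp: inj_on_def)
    show "(\<lambda>y. insert y R) ` (D - R) = {P. P \<subseteq> D \<and> card P = k \<and> R \<subseteq> P}"
    proof (intro equalityI subsetI)
      fix P assume P: "P \<in> {P. P \<subseteq> D \<and> card P = k \<and> R \<subseteq> P}"
      then have "card (P - R) = 1" using assms finR by (simp add: card_Diff_subset)
      then obtain y where "P - R = {y}" using card_1_singletonE by blast
      then show "P \<in> (\<lambda>y. insert y R) ` (D - R)" using P by (intro image_eqI[of _ _ y]) auto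
    qed (use assms finR in auto)
  qed
qed

text \<open>Freeze m - k points C of the right column. As a function of the other k points, h
  satisfies the Kneser equation on D = E - C, which has n + k points. The sum over the k-sets
  containing a (k - 1)-set R' is then the extension sum of \<open>C \<union> R'\<close>.\<close>

lemma exchange_relation_imp_extension_sums_zero:
  fixes h :: "'a set \<Rightarrow> 'k::field_char_0"
  assumes E: "finite E" "card E = n + m" and k: "0 < k" "k \<le> m" "k < n"
    and h: "exchange_relation E m k h"
  shows "extension_sums_zero E m h"
  unfolding extension_sums_zero_def
proof (intro allI impI)
  fix R assume R: "R \<subseteq> E" "Suc (card R) = m"
  have finR: "finite R" using R E finite_subset by blast
  obtain R' where R': "R' \<subseteq> R" "card R' = k - 1"
    using R k by (metis Suc_diff_1 Suc_le_mono obtain_subset_with_card_n)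
  define C where "C = R - R'"
  have finR': "finite R'" using R' finR finite_subset by blast
  have cC: "card C = m - k" using R R' k finR' by (simp add: C_def card_Diff_subset)
  have finC: "finite C" using finR C_def by simp
  have CE: "C \<subseteq> E" using R C_def by auto
  define D where "D = E - C"
  have D: "finite D" "card D = n + k"
    using E cC k CE finC by (auto simp: D_def card_Diff_subset)
  have "(\<Sum>P\<in>{P. P \<subseteq> D \<and> card P = k \<and> R' \<subseteq> P}. h (C \<union> P)) = 0"
  proof (rule kneser_superset_sum_zero[OF D \<open>k < n\<close>])
    fix P assume P: "P \<subseteq> D" "card P = k"
    have finP: "finite P" using P D finite_subset by blast
    have "card (C \<union> P) = m"
      using P finP finC cC k by (subst card_Un_disjoint) (auto simp: D_def)
    moreover have "C \<union> P \<subseteq> E" using P CE by (auto simp: D_def)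
    ultimately have "h (C \<union> P) =
      (-1) ^ k * (\<Sum>Q\<in>{Q. Q \<subseteq> E - (C \<union> P) \<and> card Q = k}. h ((C \<union> P) - P \<union> Q))"
      using h P unfolding exchange_relation_def by blast
    moreover have "E - (C \<union> P) = D - P" by (auto simp: D_def)
    moreover have "C \<union> P - P = C" using P by (auto simp: D_def)
    ultimately show "h (C \<union> P) = (-1) ^ k * (\<Sum>Q\<in>{Q. Q \<subseteq> D - P \<and> card Q = k}. h (C \<union> Q))"
      by simp
  qed (use R' R k in \<open>auto simp: D_def C_def\<close>)
  also have "(\<Sum>P\<in>{P. P \<subseteq> D \<and> card P = k \<and> R' \<subseteq> P}. h (C \<union> P)) =
      (\<Sum>y\<in>D - R'. h (C \<union> insert y R'))"
    using R' R k D by (intro sum_singletons) (auto simp: D_def C_def)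
  also have "D - R' = E - R" using R' R by (auto simp: D_def C_def)
  also have "(\<Sum>y\<in>E - R. h (C \<union> insert y R')) = (\<Sum>y\<in>E - R. h (insert y R))"
  proof -
    have "C \<union> insert y R' = insert y R" for y using R' by (auto simp: C_def)
    then show ?thesis by simp
  qed
  finally show "(\<Sum>y\<in>E - R. h (insert y R)) = 0" .
qed

text \<open>For k = 1 the exchange of a single point x is already the extension sum of R with one
  term moved to the other side. This covers two columns of length one, where k < n fails.\<close>

lemma exchange_relation_1_imp_extension_sums_zero:
  fixes h :: "'a set \<Rightarrow> 'k::comm_ring_1"
  assumes E: "finite E" "card E = n + m" and nm: "0 < n"
    and h: "exchange_relation E m 1 h"
  shows "extension_sums_zero E m h"
  unfolding extension_sums_zero_def
proof (intro allI impI)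
  fix R assume R: "R \<subseteq> E" "Suc (card R) = m"
  have finR: "finite R" using R E finite_subset by blast
  have "card (E - R) > 0" using E R nm finR by (simp add: card_Diff_subset)
  then obtain x where x: "x \<in> E - R" by (metis card_gt_0_iff ex_in_conv)
  have "insert x R \<subseteq> E" "card (insert x R) = m" "{x} \<subseteq> insert x R" "card {x} = 1"
    using x R finR by auto
  then have "h (insert x R) = (-1) ^ 1 *
      (\<Sum>Q\<in>{Q. Q \<subseteq> E - insert x R \<and> card Q = 1}. h (insert x R - {x} \<union> Q))"
    using h unfolding exchange_relation_def by blast
  also have "insert x R - {x} = R" using x by auto
  also have "{Q. Q \<subseteq> E - insert x R \<and> card Q = 1} = (\<lambda>y. {y}) ` (E - insert x R)"
    by (auto simp: card_1_singleton_iff)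
  also have "(\<Sum>Q\<in>(\<lambda>y. {y}) ` (E - insert x R). h (R \<union> Q)) = (\<Sum>y\<in>E - insert x R. h (insert y R))"
    by (subst sum.reindex) (auto simp: inj_on_def)
  finally have "h (insert x R) + (\<Sum>y\<in>E - insert x R. h (insert y R)) = 0" by simp
  moreover have "E - insert x R = (E - R) - {x}" by auto
  ultimately show "(\<Sum>y\<in>E - R. h (insert y R)) = 0"
    using x E by (simp add: sum.remove[of "E - R" x])
qed

text \<open>Again C = B - P is frozen: the extension sum of \<open>C \<union> R\<close>, for a (k -
  1)-set R of free points, is the hypothesis of \<open>kneser_relation\<close>.\<close>

lemma extension_sums_zero_imp_exchange_relation:
  fixes h :: "'a set \<Rightarrow> 'k::field_char_0"
  assumes E: "finite E" and k: "0 < k" and h: "extension_sums_zero E m h"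
  shows "exchange_relation E m k h"
  unfolding exchange_relation_def
proof (intro allI impI)
  fix B P assume B: "B \<subseteq> E" "card B = m" and P: "P \<subseteq> B" "card P = k"
  define C where "C = B - P"
  define D where "D = E - C"
  have "finite B" using B E finite_subset by blast
  moreover have "finite P" using P \<open>finite B\<close> finite_subset by blast
  ultimately have fin: "finite B" "finite P" "finite C" "finite D"
    using E by (auto simp: C_def D_def)
  have km: "k \<le> m" using P B fin card_mono by blast
  have cC: "card C = m - k" using P B fin by (simp add: C_def card_Diff_subset)
  have "h (C \<union> P) = (-1) ^ k * (\<Sum>Q\<in>{Q. Q \<subseteq> D - P \<and> card Q = k}. h (C \<union> Q))"
  proof (rule kneser_relation[OF fin(4) k])
    fix R assume R: "R \<subseteq> D" "card R = k - 1"
    have finR: "finite R" using R fin finite_subset by blast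
    have "card (C \<union> R) = m - k + (k - 1)"
      using R finR fin cC by (subst card_Un_disjoint) (auto simp: D_def)
    then have "Suc (card (C \<union> R)) = m" using k km by simp
    moreover have "C \<union> R \<subseteq> E" using R B by (auto simp: D_def C_def)
    ultimately have "(\<Sum>y\<in>E - (C \<union> R). h (insert y (C \<union> R))) = 0"
      using h unfolding extension_sums_zero_def by blast
    moreover have "E - (C \<union> R) = D - R" by (auto simp: D_def)
    ultimately have "(\<Sum>y\<in>D - R. h (C \<union> insert y R)) = 0" by simp
    then show "(\<Sum>P\<in>{P. P \<subseteq> D \<and> card P = k \<and> R \<subseteq> P}. h (C \<union> P)) = 0"
      using R k fin by (subst sum_singletons) auto
  qed (use P B in \<open>auto simp: D_def C_def\<close>)
  moreover have "C \<union> P = B" "D - P = E - B" using P B by (auto simp: C_def D_def)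
  ultimately show "h B = (-1) ^ k * (\<Sum>Q\<in>{Q. Q \<subseteq> E - B \<and> card Q = k}. h (B - P \<union> Q))"
    by (simp add: C_def)
qed

section \<open>Tableaux and their column sets\<close>

text \<open>Unlike \<open>conj_part ls ! j\<close> this is meaningful for every j, being 0 beyond
  the last column, so most statements need no bound on j.\<close>

definition col_len :: "nat list \<Rightarrow> nat \<Rightarrow> nat" where
  "col_len ls j = card {i. (i, j) \<in> young_diagram ls}"

definition column :: "nat list \<Rightarrow> tableau \<Rightarrow> nat \<Rightarrow> nat set" where
  "column ls T j = (\<lambda>i. T (i, j)) ` {..<col_len ls j}"

lemma down_closed_eq_lessThan:
  assumes "finite S" "\<And>i k. k \<in> S \<Longrightarrow> i \<le> k \<Longrightarrow> i \<in> S"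
  shows "S = {..<card S}"
proof -
  have "S = {..<n}" if "\<forall>i<n. i \<in> S" "n \<notin> S" for n
    using that assms(2) by (meson equalityI lessThan_iff not_le subsetI)
  moreover obtain n where "n \<notin> S" using assms(1) ex_new_if_finite infinite_UNIV_nat by blast
  then have "\<exists>n. (\<forall>i<n. i \<in> S) \<and> n \<notin> S"
    by (meson exists_least_iff)
  ultimately show ?thesis by (metis card_lessThan)
qed

locale partition_shape =
  fixes ls :: "nat list"
  assumes part: "is_partition ls (sum_list ls)"
begin

abbreviation "Y \<equiv> young_diagram ls"
abbreviation "r \<equiv> sum_list ls"
abbreviation "tabs \<equiv> tableaux ls"
abbreviation "L \<equiv> col_len ls"
abbreviation "col \<equiv> column ls"

section \<open>Geometry of the Young diagram\<close>

lemma nth_antimono: "i \<le> k \<Longrightarrow> k < length ls \<Longrightarrow> ls ! k \<le> ls ! i"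
  using part unfolding is_partition_def
  by (metis le_neq_implies_less order_refl sorted_wrt_iff_nth_less)

lemma col_set: "{i. (i, j) \<in> Y} = {..<L j}"
  unfolding col_len_def
proof (rule down_closed_eq_lessThan)
  show "finite {i. (i, j) \<in> Y}"
    by (rule finite_subset[of _ "{..<length ls}"]) (auto simp: young_diagram_def)
next
  fix i k assume "k \<in> {i. (i, j) \<in> Y}" "i \<le> k"
  then show "i \<in> {i. (i, j) \<in> Y}"
    using nth_antimono[of i k] by (auto simp: young_diagram_def)
qed

lemma diagram_iff: "(i, j) \<in> Y \<longleftrightarrow> i < L j"
  using col_set[of j] by auto

lemma L_antimono: "j \<le> k \<Longrightarrow> L k \<le> L j"
proof -
  assume "j \<le> k"
  then have "{i. (i, k) \<in> Y} \<subseteq> {i. (i, j) \<in> Y}"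
    by (auto simp: young_diagram_def)
  then show ?thesis by (simp add: col_set)
qed

lemma conj_part_nth: "j < length (conj_part ls) \<Longrightarrow> conj_part ls ! j = L j"
proof -
  assume j: "j < length (conj_part ls)"
  have "{i. i < length ls \<and> j < ls ! i} = {i. (i, j) \<in> Y}"
    by (auto simp: young_diagram_def)
  then show ?thesis using j
    by (simp add: conj_part_def length_filter_conv_card col_len_def)
qed

lemma less_length_conj_part: "j < length (conj_part ls) \<longleftrightarrow> 0 < L j"
proof -
  have "0 < L j \<longleftrightarrow> (0, j) \<in> Y" by (simp add: diagram_iff)
  also have "\<dots> \<longleftrightarrow> j < length (conj_part ls)"
    by (cases ls) (auto simp: young_diagram_def conj_part_def)
  finally show ?thesis by simp
qed

lemma finite_diagram: "finite Y"
  and card_diagram: "card Y = r"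
proof -
  have Y: "Y = Sigma {..<length ls} (\<lambda>i. {..<ls ! i})"
    by (auto simp: young_diagram_def)
  show "finite Y" unfolding Y by simp
  have "card Y = (\<Sum>i<length ls. ls ! i)" unfolding Y by simp
  then show "card Y = r" by (simp add: sum_list_sum_nth atLeast0LessThan)
qed

lemma tab_inj: "T \<in> tabs \<Longrightarrow> inj_on T Y"
  and tab_image: "T \<in> tabs \<Longrightarrow> T ` Y = {1..r}"
  by (auto simp: tableaux_def bij_betw_def)

lemma tab_outside: "T \<in> tabs \<Longrightarrow> x \<notin> Y \<Longrightarrow> T x = 0"
  unfolding tableaux_def by blast

lemma tab_eq_iff: "T \<in> tabs \<Longrightarrow> i < L j \<Longrightarrow> i' < L j' \<Longrightarrow> T (i, j) = T (i', j') \<longleftrightarrow> i = i' \<and> j = j'"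
  using inj_on_eq_iff[OF tab_inj, of T "(i, j)" "(i', j')"] by (simp add: diagram_iff)

lemma tab_range: "T \<in> tabs \<Longrightarrow> i < L j \<Longrightarrow> T (i, j) \<in> {1..r}"
  by (metis diagram_iff imageI tab_image)

text \<open>Surjectivity suffices, because the diagram has exactly r cells.\<close>

lemma tabI:
  assumes "T ` Y = {1..r}" "\<And>x. x \<notin> Y \<Longrightarrow> T x = 0"
  shows "T \<in> tabs"
proof -
  have "inj_on T Y"
    using assms(1) finite_diagram card_diagram by (intro eq_card_imp_inj_on) auto
  then show ?thesis using assms by (auto simp: tableaux_def bij_betw_def)
qed

lemma finite_tabs: "finite tabs"
proof -
  have "tabs \<subseteq> {T. \<forall>x. (x \<in> Y \<longrightarrow> T x \<in> {1..r}) \<and> (x \<notin> Y \<longrightarrow> T x = 0)}"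
    using tab_image tab_outside by blast
  then show ?thesis
    using finite_set_of_finite_funs[OF finite_diagram, of "{1..r}" 0] finite_subset by blast
qed

lemma perm_tab:
  assumes "T \<in> tabs" "\<sigma> permutes {1..r}"
  shows "\<sigma> \<circ> T \<in> tabs"
proof (rule tabI)
  show "(\<sigma> \<circ> T) ` Y = {1..r}"
    unfolding image_comp[symmetric] tab_image[OF assms(1)] by (rule permutes_image[OF assms(2)])
  show "(\<sigma> \<circ> T) x = 0" if "x \<notin> Y" for x
    using assms that tab_outside[OF assms(1)] by (simp add: permutes_not_in)
qed

text \<open>Exchanging two cells is acting by a transposition of values. The value 0 outside the
  diagram is not an entry and therefore stays fixed.\<close>

lemma swap_eq_transpose:
  assumes "T \<in> tabs" "p \<in> Y" "q \<in> Y"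
  shows "T(p := T q, q := T p) = transpose (T p) (T q) \<circ> T"
proof
  fix x show "(T(p := T q, q := T p)) x = (transpose (T p) (T q) \<circ> T) x"
  proof (cases "x \<in> Y")
    case True
    then show ?thesis using tab_inj[OF assms(1)] assms(2,3)
      by (auto simp: transpose_def inj_on_def)
  next
    case False
    moreover have "T p \<noteq> 0" "T q \<noteq> 0" using assms tab_image[OF assms(1)] by fastforce+
    ultimately show ?thesis using assms tab_outside[OF assms(1)]
      by (auto simp: transpose_def)
  qed
qed

text \<open>Disjointness is implied: the sizes \<open>L j\<close> add up to r, the size of the
  union.\<close>

definition column_sets :: "(nat \<Rightarrow> nat set) \<Rightarrow> bool" where
  "column_sets X \<longleftrightarrow> (\<forall>j. finite (X j) \<and> card (X j) = L j) \<and> (\<Union>j. X j) = {1..r}"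

lemma finite_col: "finite (col T j)"
  by (simp add: column_def)

lemma col_memI: "i < L j \<Longrightarrow> T (i, j) \<in> col T j"
  by (auto simp: column_def)

lemma card_col: "T \<in> tabs \<Longrightarrow> card (col T j) = L j"
  by (simp add: column_def card_image inj_on_def tab_eq_iff)

lemma Union_col_eq_image: "(\<Union>j. col T j) = T ` Y"
  unfolding column_def by (force simp: diagram_iff)

lemma Union_col: "T \<in> tabs \<Longrightarrow> (\<Union>j. col T j) = {1..r}"
  by (simp only: Union_col_eq_image tab_image)

lemma column_sets_col: "T \<in> tabs \<Longrightarrow> column_sets (col T)"
  by (simp add: column_sets_def finite_col card_col Union_col)

lemma col_subset: "T \<in> tabs \<Longrightarrow> col T j \<subseteq> {1..r}"
  using Union_col by blast

lemma col_disjoint: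
  assumes "T \<in> tabs" "j \<noteq> j'"
  shows "col T j \<inter> col T j' = {}"
proof (rule ccontr)
  assume "col T j \<inter> col T j' \<noteq> {}"
  then obtain i i' where "i < L j" "i' < L j'" "T (i, j) = T (i', j')"
    unfolding column_def by blast
  then show False using assms by (simp add: tab_eq_iff)
qed

lemma col_perm: "col (\<sigma> \<circ> T) j = \<sigma> ` col T j"
  by (auto simp: column_def)

definition tab_of_lists :: "(nat \<Rightarrow> nat list) \<Rightarrow> tableau" where
  "tab_of_lists W = (\<lambda>(i, j). if i < L j then W j ! i else 0)"

lemma tab_of_lists:
  assumes X: "column_sets X" and W: "\<And>j. set (W j) = X j" "\<And>j. distinct (W j)"
  shows "tab_of_lists W \<in> tabs" "col (tab_of_lists W) = X"
proof -
  have len: "length (W j) = L j" for j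
    using X W by (metis column_sets_def distinct_card)
  show col: "col (tab_of_lists W) = X"
  proof
    fix j show "col (tab_of_lists W) j = X j"
      unfolding W(1)[symmetric] by (auto simp: column_def tab_of_lists_def set_conv_nth len)
  qed
  show "tab_of_lists W \<in> tabs"
  proof (rule tabI)
    show "tab_of_lists W ` Y = {1..r}"
      using X unfolding Union_col_eq_image[symmetric] col column_sets_def by blast
    show "tab_of_lists W x = 0" if "x \<notin> Y" for x
      using that by (cases x) (auto simp: tab_of_lists_def diagram_iff)
  qed
qed

text \<open>A tableau has a sign only relative to a base tableau. Another base multiplies all signs
  by a common factor, which linear homogeneous relations do not see.\<close>

definition ref_tab :: tableau where
  "ref_tab = (SOME T. T \<in> tabs)"

definition tab_perm :: "tableau \<Rightarrow> nat \<Rightarrow> nat" where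
  "tab_perm T x = (if x \<in> {1..r} then T (inv_into Y ref_tab x) else x)"

definition tab_sign :: "tableau \<Rightarrow> int" where
  "tab_sign T = sign (tab_perm T)"

lemma tab_perm_permutes:
  assumes "T \<in> tabs"
  shows "tab_perm T permutes {1..r}"
proof (rule bij_imp_permutes)
  have "ref_tab \<in> tabs" using assms unfolding ref_tab_def by (metis someI)
  then have "bij_betw (inv_into Y ref_tab) {1..r} Y"
    by (intro bij_betw_inv_into) (simp add: tableaux_def)
  moreover have "bij_betw T Y {1..r}" using assms by (simp add: tableaux_def)
  ultimately have "bij_betw (T \<circ> inv_into Y ref_tab) {1..r} {1..r}"
    by (rule bij_betw_trans)
  then show "bij_betw (tab_perm T) {1..r} {1..r}"
    by (rule bij_betw_cong[THEN iffD1, rotated]) (simp add: tab_perm_def)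
qed (auto simp: tab_perm_def)

lemma tab_sign_square: "tab_sign T * tab_sign T = 1"
  by (simp add: tab_sign_def sign_def)

lemma tab_sign_perm:
  assumes T: "T \<in> tabs" and \<sigma>: "\<sigma> permutes {1..r}"
  shows "tab_sign (\<sigma> \<circ> T) = sign \<sigma> * tab_sign T"
proof -
  have "tab_perm (\<sigma> \<circ> T) = \<sigma> \<circ> tab_perm T"
    using \<sigma> by (auto simp: fun_eq_iff tab_perm_def permutes_not_in)
  moreover have "permutation \<sigma>" "permutation (tab_perm T)"
    using \<sigma> tab_perm_permutes[OF T] by (auto simp: permutation_permutes)
  ultimately show ?thesis by (simp add: tab_sign_def sign_compose)
qed

definition column_alternating :: "(tableau \<Rightarrow> 'k::comm_ring_1) \<Rightarrow> bool" where
  "column_alternating a \<longleftrightarrow> (\<forall>T\<in>tabs. \<forall>j i i'. i < L j \<longrightarrow> i' < L j \<longrightarrow> i \<noteq> i' \<longrightarrow>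
     a (transpose (T (i, j)) (T (i', j)) \<circ> T) = - a T)"

definition twist :: "(tableau \<Rightarrow> 'k::comm_ring_1) \<Rightarrow> tableau \<Rightarrow> 'k" where
  "twist a T = of_int (tab_sign T) * a T"

lemma untwist: "a T = of_int (tab_sign T) * twist a T"
  unfolding twist_def by (simp add: tab_sign_square flip: mult.assoc of_int_mult)

lemma twist_swap:
  assumes a: "column_alternating a" and T: "T \<in> tabs" and i: "i < L j" "i' < L j" "i \<noteq> i'"
  shows "twist a (transpose (T (i, j)) (T (i', j)) \<circ> T) = twist a T"
proof -
  have ne: "T (i, j) \<noteq> T (i', j)" using T i by (simp add: tab_eq_iff)
  have "transpose (T (i, j)) (T (i', j)) permutes {1..r}"
    by (intro permutes_swap_id tab_range T i)
  then have "tab_sign (transpose (T (i, j)) (T (i', j)) \<circ> T) = - tab_sign T"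
    using ne T by (simp add: tab_sign_perm sign_swap_id)
  then show ?thesis using a T i by (simp add: twist_def column_alternating_def)
qed

text \<open>Induction on the number of cells where T and S differ: one swap inside a column moves
  the entry wanted at (i, j) into place without spoiling any agreement, and the twist is invariant
  under such swaps.\<close>

lemma twist_cong:
  assumes a: "column_alternating a" and T: "T \<in> tabs" and S: "S \<in> tabs" and eq: "col T = col S"
  shows "twist a T = twist a S"
  using T eq
proof (induction "card {p \<in> Y. T p \<noteq> S p}" arbitrary: T rule: less_induct)
  case (less T)
  show ?case
  proof (cases "\<forall>p\<in>Y. T p = S p")
    case True
    then have "T = S"
      using tab_outside[OF S] tab_outside[OF less.prems(1)] by (auto simp: fun_eq_iff)
    then show ?thesis by simp
  next
    case False
    then obtain i j where ij: "i < L j" "T (i, j) \<noteq> S (i, j)" by (auto simp: diagram_iff)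
    then have "S (i, j) \<in> col S j" by (auto simp: column_def)
    then have "S (i, j) \<in> col T j" using less.prems by simp
    then obtain i' where i': "i' < L j" "T (i', j) = S (i, j)" by (auto simp: column_def)
    have ne: "i \<noteq> i'" using ij i' by auto
    let ?T = "transpose (T (i, j)) (T (i', j)) \<circ> T"
    have perm: "transpose (T (i, j)) (T (i', j)) permutes {1..r}"
      by (intro permutes_swap_id tab_range less.prems ij i')
    have tab: "?T \<in> tabs" using perm_tab[OF less.prems(1) perm] .
    have "transpose (T (i, j)) (T (i', j)) ` col T j' = col T j'" for j'
    proof (cases "j' = j")
      case True
      then show ?thesis using col_memI[OF ij(1), of T] col_memI[OF i'(1), of T] by (simp add: transpose_image_eq)
    next
      case False
      then have "T (i, j) \<notin> col T j'" "T (i', j) \<notin> col T j'"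
        using col_disjoint[OF less.prems(1)] col_memI[OF ij(1), of T] col_memI[OF i'(1), of T]
        by blast+
      then show ?thesis by (simp add: transpose_image_eq)
    qed
    then have col: "col ?T = col S" using less.prems(2) by (simp add: fun_eq_iff col_perm)
    \<comment> \<open>As T (i', j) = S (i, j), this shows that T and S already differ at (i', j), so
      the swap loses no agreement there.\<close>
    have Sne: "S (i', j) \<noteq> S (i, j)" using S ij i' ne by (simp add: tab_eq_iff)
    have "{p \<in> Y. ?T p \<noteq> S p} \<subset> {p \<in> Y. T p \<noteq> S p}"
    proof
      show "{p \<in> Y. ?T p \<noteq> S p} \<subseteq> {p \<in> Y. T p \<noteq> S p}"
      proof
        fix p assume p: "p \<in> {p \<in> Y. ?T p \<noteq> S p}"
        show "p \<in> {p \<in> Y. T p \<noteq> S p}"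
        proof (cases "p = (i, j) \<or> p = (i', j)")
          case True
          then show ?thesis using p ij i' Sne by auto
        next
          case False
          have "p \<in> Y" "(i, j) \<in> Y" "(i', j) \<in> Y"
            using p ij(1) i'(1) by (simp_all add: diagram_iff)
          then have "T p \<noteq> T (i, j)" "T p \<noteq> T (i', j)"
            using False inj_on_eq_iff[OF tab_inj[OF less.prems(1)]] by blast+
          then show ?thesis using p by (simp add: transpose_def)
        qed
      qed
      have "(i, j) \<in> Y" using ij(1) by (simp add: diagram_iff)
      moreover have "?T (i, j) = S (i, j)" using i'(2) by simp
      ultimately have "(i, j) \<in> {p \<in> Y. T p \<noteq> S p} - {p \<in> Y. ?T p \<noteq> S p}"
        using ij(2) by blast
      then show "{p \<in> Y. ?T p \<noteq> S p} \<noteq> {p \<in> Y. T p \<noteq> S p}" by blast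
    qed
    then have "card {p \<in> Y. ?T p \<noteq> S p} < card {p \<in> Y. T p \<noteq> S p}"
      using finite_diagram by (intro psubset_card_mono) auto
    then have "twist a ?T = twist a S" using less.hyps tab col by blast
    then show ?thesis using twist_swap[OF a less.prems(1) ij(1) i'(1) ne] by simp
  qed
qed

text \<open>The choice is harmless by \<open>twist_cong\<close>. The value has a meaning only when X
  is the family of columns of some tableau.\<close>

definition on_columns :: "(tableau \<Rightarrow> 'k::comm_ring_1) \<Rightarrow> (nat \<Rightarrow> nat set) \<Rightarrow> 'k" where
  "on_columns a X = twist a (SOME T. T \<in> tabs \<and> col T = X)"

lemma on_columns_col:
  assumes "column_alternating a" "T \<in> tabs"
  shows "on_columns a (col T) = twist a T"
proof -
  have "(SOME S. S \<in> tabs \<and> col S = col T) \<in> tabs \<and> col (SOME S. S \<in> tabs \<and> col S = col T) = col T"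
    by (rule someI[where P = "\<lambda>S. S \<in> tabs \<and> col S = col T" and x = T]) (simp add: assms)
  then show ?thesis unfolding on_columns_def using twist_cong assms by blast
qed

end

section \<open>Garnir relations in terms of column sets\<close>

text \<open>The exchange of two disjoint k-sets as a product of k transpositions, so that its sign
  (-1)^k can be read off.\<close>

primrec swap_pairs :: "(nat \<Rightarrow> 'a) \<Rightarrow> (nat \<Rightarrow> 'a) \<Rightarrow> nat \<Rightarrow> 'a \<Rightarrow> 'a" where
  "swap_pairs p q 0 = id"
| "swap_pairs p q (Suc k) = transpose (p k) (q k) \<circ> swap_pairs p q k"

lemma swap_pairs_other:
  "x \<notin> p ` {..<k} \<Longrightarrow> x \<notin> q ` {..<k} \<Longrightarrow> swap_pairs p q k x = x"
  by (induction k) (auto simp: lessThan_Suc)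

lemma swap_pairs_apply:
  assumes "inj_on p {..<k}" "inj_on q {..<k}" "p ` {..<k} \<inter> q ` {..<k} = {}" "i < k"
  shows "swap_pairs p q k (p i) = q i \<and> swap_pairs p q k (q i) = p i"
  using assms
proof (induction k)
  case (Suc k)
  have IH: "swap_pairs p q k (p i) = q i \<and> swap_pairs p q k (q i) = p i" if "i < k"
    using Suc that by (auto simp: lessThan_Suc)
  have pk: "p k \<notin> p ` {..<k}" "p k \<notin> q ` {..<k}" "q k \<notin> p ` {..<k}" "q k \<notin> q ` {..<k}"
    using Suc.prems by (auto simp: lessThan_Suc)
  show ?case
  proof (cases "i = k")
    case True
    then show ?thesis using pk by (simp add: swap_pairs_other)
  next
    case False
    then have i: "i < k" using Suc.prems by simp
    then have "p i \<in> p ` {..<k}" "q i \<in> q ` {..<k}" by auto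
    then have "p i \<noteq> p k" "p i \<noteq> q k" "q i \<noteq> p k" "q i \<noteq> q k" using pk by metis+
    then show ?thesis using IH[OF i] by simp
  qed
qed simp

lemma swap_pairs_permutes:
  "p ` {..<k} \<subseteq> S \<Longrightarrow> q ` {..<k} \<subseteq> S \<Longrightarrow> swap_pairs p q k permutes S"
  by (induction k) (auto simp: lessThan_Suc permutes_id intro!: permutes_compose permutes_swap_id)

lemma sign_swap_pairs:
  assumes "finite S" "p ` {..<k} \<subseteq> S" "q ` {..<k} \<subseteq> S" "p ` {..<k} \<inter> q ` {..<k} = {}"
  shows "sign (swap_pairs p q k) = (-1) ^ k"
  using assms
proof (induction k)
  case (Suc k)
  have "permutation (swap_pairs p q k)"
    using swap_pairs_permutes[of p k S q] Suc.prems by (auto simp: lessThan_Suc permutation_permutes)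
  moreover have "p k \<noteq> q k" using Suc.prems by (auto simp: lessThan_Suc)
  moreover have "sign (swap_pairs p q k) = (-1) ^ k"
    using Suc by (auto simp: lessThan_Suc)
  ultimately show ?case
    unfolding swap_pairs.simps by (simp add: sign_compose sign_swap_id permutation_swap_id del: o_apply)
qed (simp add: sign_id)

lemma swap_pairs_image:
  assumes "inj_on p {..<k}" "inj_on q {..<k}" "p ` {..<k} \<inter> q ` {..<k} = {}"
    and "q ` {..<k} \<subseteq> X" "p ` {..<k} \<inter> X = {}"
  shows "swap_pairs p q k ` X = X - q ` {..<k} \<union> p ` {..<k}"
proof -
  have "X = (X - q ` {..<k}) \<union> q ` {..<k}" using assms by auto
  then have "swap_pairs p q k ` X =
      swap_pairs p q k ` (X - q ` {..<k}) \<union> swap_pairs p q k ` q ` {..<k}"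
    by (metis image_Un)
  also have "swap_pairs p q k ` (X - q ` {..<k}) = (\<lambda>x. x) ` (X - q ` {..<k})"
    using assms by (intro image_cong swap_pairs_other) auto
  also have "swap_pairs p q k ` q ` {..<k} = p ` {..<k}"
    unfolding image_image using assms by (intro image_cong) (auto simp: swap_pairs_apply)
  finally show ?thesis by simp
qed

lemma swap_pairs_image':
  assumes "inj_on p {..<k}" "inj_on q {..<k}" "p ` {..<k} \<inter> q ` {..<k} = {}"
    and "p ` {..<k} \<subseteq> X" "q ` {..<k} \<inter> X = {}"
  shows "swap_pairs p q k ` X = X - p ` {..<k} \<union> q ` {..<k}"
proof -
  have "X = (X - p ` {..<k}) \<union> p ` {..<k}" using assms by auto
  then have "swap_pairs p q k ` X =
      swap_pairs p q k ` (X - p ` {..<k}) \<union> swap_pairs p q k ` p ` {..<k}"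
    by (metis image_Un)
  also have "swap_pairs p q k ` (X - p ` {..<k}) = (\<lambda>x. x) ` (X - p ` {..<k})"
    using assms by (intro image_cong swap_pairs_other) auto
  also have "swap_pairs p q k ` p ` {..<k} = q ` {..<k}"
    unfolding image_image using assms by (intro image_cong) (auto simp: swap_pairs_apply)
  finally show ?thesis by simp
qed

text \<open>\<open>garnir_exchange\<close> describes the order inside A by rank in one direction and
  by the sorted list in the other; this reconciles the two.\<close>

lemma card_less_nth_sorted_list_of_set:
  fixes A :: "nat set"
  assumes "finite A" "t < card A"
  shows "card {a \<in> A. a < sorted_list_of_set A ! t} = t"
proof -
  let ?xs = "sorted_list_of_set A"
  have len: "length ?xs = card A" by simp
  have st: "sorted_wrt (<) ?xs" by (rule strict_sorted_list_of_set)
  have set: "set ?xs = A" using assms by simp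
  have "{a \<in> A. a < ?xs ! t} = (!) ?xs ` {..<t}"
  proof (intro equalityI subsetI)
    fix a assume a: "a \<in> {a \<in> A. a < ?xs ! t}"
    then obtain s where s: "s < card A" "a = ?xs ! s"
      using set len by (metis (no_types, lifting) in_set_conv_nth mem_Collect_eq)
    have "s < t"
    proof (rule ccontr)
      assume "\<not> s < t"
      then have "?xs ! t \<le> ?xs ! s"
        using sorted_nth_mono[of ?xs t s] s by simp
      then show False using a s by simp
    qed
    then show "a \<in> (!) ?xs ` {..<t}" using s by auto
  next
    fix a assume "a \<in> (!) ?xs ` {..<t}"
    then obtain s where s: "s < t" "a = ?xs ! s" by auto
    then have "a \<in> set ?xs" using assms len by (metis nth_mem order.strict_trans)
    moreover have "a < ?xs ! t" using st s assms len by (simp add: sorted_wrt_iff_nth_less)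
    ultimately show "a \<in> {a \<in> A. a < ?xs ! t}" using set by simp
  qed
  moreover have "inj_on ((!) ?xs) {..<t}"
    using assms len by (intro inj_on_nth) auto
  ultimately show ?thesis by (simp add: card_image)
qed

lemma nth_sorted_list_of_set_image:
  fixes A :: "nat set"
  assumes "finite A"
  shows "(!) (sorted_list_of_set A) ` {..<card A} = A"
proof -
  have "set (sorted_list_of_set A) = (!) (sorted_list_of_set A) ` {..<length (sorted_list_of_set A)}"
    by (auto simp: set_conv_nth)
  then show ?thesis using assms by simp
qed

lemma bij_betw_image_subsets_card:
  assumes "inj_on f S"
  shows "bij_betw (\<lambda>A. f ` A) {A. A \<subseteq> S \<and> card A = k} {Q. Q \<subseteq> f ` S \<and> card Q = k}"
  unfolding bij_betw_def
proof
  show "inj_on ((`) f) {A. A \<subseteq> S \<and> card A = k}"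
    using inj_on_image_Pow[OF assms] by (rule inj_on_subset) auto
  have card: "card (f ` A) = card A" if "A \<subseteq> S" for A
    using assms that by (meson card_image inj_on_subset)
  show "(`) f ` {A. A \<subseteq> S \<and> card A = k} = {Q. Q \<subseteq> f ` S \<and> card Q = k}"
  proof (intro equalityI subsetI)
    fix Q assume Q: "Q \<in> {Q. Q \<subseteq> f ` S \<and> card Q = k}"
    then obtain A where "A \<subseteq> S" "Q = f ` A" by (auto simp: subset_image_iff)
    then show "Q \<in> (`) f ` {A. A \<subseteq> S \<and> card A = k}" using Q card by auto
  qed (use card in auto)
qed

context partition_shape
begin

lemma L_Suc_le: "L (Suc c) \<le> L c"
  by (rule L_antimono) simp

text \<open>All three claims follow once the exchange is written as \<open>swap_pairs p q k\<close>
  acting on the entries of T, where p and q list the two exchanged sets from top to bottom.\<close>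

lemma garnir_exchange:
  assumes T: "T \<in> tabs" and A: "A \<subseteq> {0..<L c}" "card A \<le> L (Suc c)"
  defines "P \<equiv> (\<lambda>i. T (i, Suc c)) ` {..<card A}" and "Q \<equiv> (\<lambda>i. T (i, c)) ` A"
  shows "garnir_exchange T c A \<in> tabs"
    and "tab_sign (garnir_exchange T c A) = (-1) ^ card A * tab_sign T"
    and "col (garnir_exchange T c A) =
         (col T)(c := col T c - Q \<union> P, Suc c := col T (Suc c) - P \<union> Q)"
proof -
  define k where "k = card A"
  define p where "p i = T (i, Suc c)" for i
  define q where "q i = T (sorted_list_of_set A ! i, c)" for i
  have finA: "finite A" using A(1) finite_subset by blast
  let ?xs = "sorted_list_of_set A"
  have xs: "?xs ! i \<in> A" "?xs ! i < L c" if "i < k" for i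
  proof -
    show "?xs ! i \<in> A"
      using nth_sorted_list_of_set_image[OF finA] that by (auto simp: k_def)
    then show "?xs ! i < L c" using A(1) by auto
  qed
  have ps: "p ` {..<k} = P" by (simp add: P_def k_def p_def)
  have qs: "q ` {..<k} = Q"
  proof -
    have "q ` {..<k} = (\<lambda>i. T (i, c)) ` ((!) ?xs ` {..<card A})"
      by (simp add: q_def k_def image_image)
    then show ?thesis unfolding Q_def nth_sorted_list_of_set_image[OF finA] .
  qed
  have Pc: "P \<subseteq> col T (Suc c)" using A(2) by (auto simp: P_def column_def)
  have Qc: "Q \<subseteq> col T c" using A(1) by (auto simp: Q_def column_def)
  have disj: "p ` {..<k} \<inter> q ` {..<k} = {}"
    using Pc Qc col_disjoint[OF T, of c "Suc c"] unfolding ps qs by auto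
  have rng: "p ` {..<k} \<subseteq> {1..r}" "q ` {..<k} \<subseteq> {1..r}"
    unfolding ps qs using Pc Qc col_subset[OF T] by blast+
  have injp: "inj_on p {..<k}"
    using A(2) T by (auto simp: inj_on_def p_def k_def tab_eq_iff)
  have injq: "inj_on q {..<k}"
  proof (rule inj_onI)
    fix x y assume xy: "x \<in> {..<k}" "y \<in> {..<k}" "q x = q y"
    then have "?xs ! x = ?xs ! y" using T xs by (simp add: q_def tab_eq_iff)
    then show "x = y" using xy by (simp add: k_def nth_eq_iff_index_eq)
  qed
  let ?s = "swap_pairs p q k"
  have eq: "garnir_exchange T c A = ?s \<circ> T"
  proof
    fix x :: "nat \<times> nat"
    obtain i j where x: "x = (i, j)" by fastforce
    show "garnir_exchange T c A x = (?s \<circ> T) x"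
    proof (cases "j = c \<and> i \<in> A")
      case True
      have "i \<in> (!) ?xs ` {..<k}"
        unfolding k_def nth_sorted_list_of_set_image[OF finA] using True by simp
      then obtain t where t: "t < k" "i = ?xs ! t" by blast
      have "card {a \<in> A. a < i} = t"
        unfolding t(2) by (rule card_less_nth_sorted_list_of_set[OF finA t(1)[unfolded k_def]])
      then have "garnir_exchange T c A x = p t"
        using True unfolding x by (simp add: garnir_exchange_def p_def)
      moreover have "T x = q t"
        unfolding x q_def t(2)[symmetric] using True by blast
      then have "(?s \<circ> T) x = p t"
        unfolding comp_apply using swap_pairs_apply[OF injp injq disj t(1)] by presburger
      ultimately show ?thesis by (rule trans[OF _ sym])
    next
      case False
      show ?thesis
      proof (cases "j = Suc c \<and> i < card A")
        case True
        then have "?s (T x) = q i"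
          using swap_pairs_apply[OF injp injq disj, of i] x by (simp add: p_def k_def)
        then show ?thesis using True x by (simp add: garnir_exchange_def q_def)
      next
        case False2: False
        have "T x \<notin> P \<and> T x \<notin> Q"
        proof (cases "x \<in> Y")
          case True
          then have i: "i < L j" using x by (simp add: diagram_iff)
          have "T (i, j) \<noteq> T (i', Suc c)" if "i' < card A" for i'
            using that False2 A(2) i T by (auto simp: tab_eq_iff)
          moreover have "T (i, j) \<noteq> T (i', c)" if "i' \<in> A" for i'
          proof -
            have "i' < L c" using that A(1) by auto
            then show ?thesis using that False i T by (auto simp: tab_eq_iff)
          qed
          ultimately show ?thesis using x by (auto simp: P_def Q_def)
        next
          case False
          \<comment> \<open>The default value 0 is not among the entries, so the swaps fix the cells
            outside the diagram.\<close>
          then have "T x = 0" by (rule tab_outside[OF T])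
          then show ?thesis using rng ps qs by auto
        qed
        then have "?s (T x) = T x" by (simp add: swap_pairs_other ps qs)
        then show ?thesis using False False2 x by (auto simp: garnir_exchange_def)
      qed
    qed
  qed
  have perm: "?s permutes {1..r}" by (rule swap_pairs_permutes[OF rng])
  show "garnir_exchange T c A \<in> tabs" unfolding eq by (rule perm_tab[OF T perm])
  show "tab_sign (garnir_exchange T c A) = (-1) ^ card A * tab_sign T"
    unfolding eq k_def[symmetric] tab_sign_perm[OF T perm]
      sign_swap_pairs[OF finite_atLeastAtMost rng disj] by (rule refl)
  show "col (garnir_exchange T c A) =
         (col T)(c := col T c - Q \<union> P, Suc c := col T (Suc c) - P \<union> Q)"
  proof
    fix j
    have d: "P \<inter> col T c = {}" "Q \<inter> col T (Suc c) = {}"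
      using Pc Qc col_disjoint[OF T, of c "Suc c"] by auto
    consider "j = c" | "j = Suc c" | "j \<noteq> c" "j \<noteq> Suc c" by blast
    then show "col (garnir_exchange T c A) j =
         ((col T)(c := col T c - Q \<union> P, Suc c := col T (Suc c) - P \<union> Q)) j"
    proof cases
      case 1
      then show ?thesis unfolding eq col_perm
        using swap_pairs_image[OF injp injq disj, of "col T c"] d Qc ps qs by simp
    next
      case 2
      then show ?thesis unfolding eq col_perm
        using swap_pairs_image'[OF injp injq disj, of "col T (Suc c)"] d Pc ps qs by simp
    next
      case 3
      have "x \<notin> P \<and> x \<notin> Q" if "x \<in> col T j" for x
        using that Pc Qc col_disjoint[OF T 3(1)] col_disjoint[OF T 3(2)] by auto
      then have "?s ` col T j = (\<lambda>x. x) ` col T j"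
        by (intro image_cong swap_pairs_other) (auto simp: ps qs)
      then show ?thesis unfolding eq col_perm using 3 by simp
    qed
  qed
qed

section \<open>From Garnir relations to functions of the right column\<close>

definition garnir_at :: "(tableau \<Rightarrow> 'k::comm_ring_1) \<Rightarrow> tableau \<Rightarrow> nat \<Rightarrow> nat \<Rightarrow> bool" where
  "garnir_at a T c k \<longleftrightarrow>
     a T = (\<Sum>A\<in>{A. A \<subseteq> {0..<L c} \<and> card A = k}. a (garnir_exchange T c A))"

text \<open>With the union of columns c and c + 1 and all other columns fixed, the column sets are
  determined by the right column B alone.\<close>

definition redistribute :: "(nat \<Rightarrow> nat set) \<Rightarrow> nat \<Rightarrow> nat set \<Rightarrow> nat \<Rightarrow> nat set" where
  "redistribute X c B = X(c := X c \<union> X (Suc c) - B, Suc c := B)"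

lemma redistribute_redistribute:
  "B \<subseteq> X c \<union> X (Suc c) \<Longrightarrow> redistribute (redistribute X c B) c B' = redistribute X c B'"
  by (auto simp: redistribute_def fun_eq_iff)

lemma redistribute_self:
  assumes "T \<in> tabs"
  shows "redistribute (col T) c (col T (Suc c)) = col T"
  using col_disjoint[OF assms, of c "Suc c"] by (auto simp: redistribute_def fun_eq_iff)

lemma card_pair:
  assumes "T \<in> tabs"
  shows "card (col T c \<union> col T (Suc c)) = L c + L (Suc c)"
  using assms col_disjoint[OF assms, of c "Suc c"] by (simp add: card_Un_disjoint finite_col card_col)

lemma column_sets_redistribute:
  assumes T: "T \<in> tabs" and B: "B \<subseteq> col T c \<union> col T (Suc c)" "card B = L (Suc c)"
  shows "column_sets (redistribute (col T) c B)"
proof -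
  have finB: "finite B" using B finite_col by (metis finite_Un finite_subset)
  have "card (col T c \<union> col T (Suc c) - B) = L c"
    using B finB card_pair[OF T] by (simp add: card_Diff_subset)
  moreover have "(\<Union>j. redistribute (col T) c B j) = (\<Union>j. col T j)"
  proof (intro equalityI subsetI)
    fix x assume "x \<in> (\<Union>j. redistribute (col T) c B j)"
    then show "x \<in> (\<Union>j. col T j)"
      using B(1) by (auto simp: redistribute_def split: if_splits)
  next
    fix x assume "x \<in> (\<Union>j. col T j)"
    then obtain j where j: "x \<in> col T j" by blast
    show "x \<in> (\<Union>j. redistribute (col T) c B j)"
    proof (cases "j = c \<or> j = Suc c")
      case True
      then have "x \<in> redistribute (col T) c B c \<or> x \<in> redistribute (col T) c B (Suc c)"
        using j by (auto simp: redistribute_def)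
      then show ?thesis by blast
    next
      case False
      then have "x \<in> redistribute (col T) c B j" using j by (simp add: redistribute_def)
      then show ?thesis by blast
    qed
  qed
  ultimately show ?thesis
    using T finB B by (simp add: column_sets_def Union_col)
      (simp add: redistribute_def card_col finite_col)
qed

text \<open>The function h of the overview, for the columns c and c + 1 of T.\<close>

definition pair_fun :: "(tableau \<Rightarrow> 'k::comm_ring_1) \<Rightarrow> tableau \<Rightarrow> nat \<Rightarrow> nat set \<Rightarrow> 'k" where
  "pair_fun a T c B = on_columns a (redistribute (col T) c B)"

lemma pair_fun_eq_twist:
  assumes "column_alternating a" "S \<in> tabs" "col S = redistribute (col T) c B"
  shows "pair_fun a T c B = twist a S"
  using on_columns_col[OF assms(1,2)] assms(3) by (simp add: pair_fun_def)

text \<open>Each exchange changes the sign of the tableau by (-1)^k, which is where the factor comes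
  from. Multiplying by \<open>tab_sign T\<close> is reversible because its square is 1. Only the top
  k entries of T play the role of P here.\<close>

lemma garnir_at_iff:
  assumes a: "column_alternating a" and T: "T \<in> tabs" and k: "k \<le> L (Suc c)"
  defines "B \<equiv> col T (Suc c)" and "P \<equiv> (\<lambda>i. T (i, Suc c)) ` {..<k}"
  shows "garnir_at a T c k \<longleftrightarrow>
    pair_fun a T c B = (-1) ^ k *
      (\<Sum>Q\<in>{Q. Q \<subseteq> (col T c \<union> col T (Suc c)) - B \<and> card Q = k}. pair_fun a T c (B - P \<union> Q))"
proof -
  let ?\<A> = "{A. A \<subseteq> {0..<L c} \<and> card A = k}"
  let ?f = "\<lambda>i. T (i, c)"
  have disj: "col T c \<inter> col T (Suc c) = {}" using col_disjoint[OF T] by simp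
  have PB: "P \<subseteq> B" using k by (auto simp: P_def B_def column_def)
  have inj: "inj_on ?f {0..<L c}" using T by (auto simp: inj_on_def tab_eq_iff)
  have "(col T c \<union> col T (Suc c)) - B = ?f ` {0..<L c}"
    using disj unfolding B_def by (simp add: column_def atLeast0LessThan Un_Diff Diff_triv)
  then have "(\<Sum>Q\<in>{Q. Q \<subseteq> (col T c \<union> col T (Suc c)) - B \<and> card Q = k}. pair_fun a T c (B - P \<union> Q)) =
      (\<Sum>A\<in>?\<A>. pair_fun a T c (B - P \<union> ?f ` A))"
    by (simp only:) (rule sum.reindex_bij_betw[OF bij_betw_image_subsets_card[OF inj], symmetric])
  also have "\<dots> = (\<Sum>A\<in>?\<A>. (-1) ^ k * of_int (tab_sign T) * a (garnir_exchange T c A))"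
  proof (rule sum.cong)
    fix A assume "A \<in> ?\<A>"
    then have A: "A \<subseteq> {0..<L c}" "card A = k" by auto
    note ge = garnir_exchange[OF T A(1), unfolded A(2), OF k, folded P_def]
    have "?f ` A \<subseteq> col T c" using A(1) by (auto simp: column_def)
    then have "col T c - ?f ` A \<union> P = col T c \<union> col T (Suc c) - (B - P \<union> ?f ` A)"
      using disj PB by (auto simp: B_def)
    then have "col (garnir_exchange T c A) = redistribute (col T) c (B - P \<union> ?f ` A)"
      unfolding ge(3) redistribute_def B_def by simp
    from pair_fun_eq_twist[OF a ge(1) this]
    show "pair_fun a T c (B - P \<union> ?f ` A) =
        (-1) ^ k * of_int (tab_sign T) * a (garnir_exchange T c A)"
      by (simp add: twist_def ge(2))
  qed simp
  also have "(-1) ^ k * \<dots> = of_int (tab_sign T) * (\<Sum>A\<in>?\<A>. a (garnir_exchange T c A))"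
  proof -
    have "(-1) ^ k * ((-1) ^ k * y) = y" for y :: 'a
      by (simp flip: power_add mult.assoc)
    then show ?thesis by (simp add: sum_distrib_left mult.assoc)
  qed
  finally have rhs: "(-1) ^ k * (\<Sum>Q\<in>{Q. Q \<subseteq> (col T c \<union> col T (Suc c)) - B \<and> card Q = k}.
      pair_fun a T c (B - P \<union> Q)) = of_int (tab_sign T) * (\<Sum>A\<in>?\<A>. a (garnir_exchange T c A))"
    by simp
  have "pair_fun a T c B = of_int (tab_sign T) * a T"
    using pair_fun_eq_twist[OF a T] redistribute_self[OF T] by (simp add: B_def twist_def)
  moreover have "of_int (tab_sign T) * x = of_int (tab_sign T) * y \<longleftrightarrow> x = y" for x y :: 'a
  proof
    assume "of_int (tab_sign T) * x = of_int (tab_sign T) * y"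
    then have "of_int (tab_sign T) * (of_int (tab_sign T) * x) =
        of_int (tab_sign T) * (of_int (tab_sign T) * y)" by simp
    then show "x = y" by (simp add: tab_sign_square flip: mult.assoc of_int_mult)
  qed simp
  ultimately show ?thesis unfolding garnir_at_def rhs by simp
qed

text \<open>An arbitrary pair of B and P inside B is realised by a tableau S whose right column is B
  with P on top. The Garnir relation is therefore needed at all such S, not only at T.\<close>

lemma garnir_at_imp_exchange_relation:
  assumes a: "column_alternating a" and T: "T \<in> tabs" and k: "k \<le> L (Suc c)"
    and g: "\<And>S. S \<in> tabs \<Longrightarrow> garnir_at a S c k"
  shows "exchange_relation (col T c \<union> col T (Suc c)) (L (Suc c)) k (pair_fun a T c)"
  unfolding exchange_relation_def
proof (intro allI impI)
  fix B P assume B: "B \<subseteq> col T c \<union> col T (Suc c)" "card B = L (Suc c)" and P: "P \<subseteq> B" "card P = k"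
  let ?X = "redistribute (col T) c B"
  have finB: "finite B" using B(1) finite_col by (metis finite_Un finite_subset)
  have finP: "finite P" using P finB finite_subset by blast
  have X: "column_sets ?X" by (rule column_sets_redistribute[OF T B])
  have finX: "finite (?X j)" for j using X by (simp add: column_sets_def)
  \<comment> \<open>Listing P before B - P puts P into the top k cells of column c + 1.\<close>
  define W where "W j = (if j = Suc c then sorted_list_of_set P @ sorted_list_of_set (B - P)
                         else sorted_list_of_set (?X j))" for j
  have W: "set (W j) = ?X j" "distinct (W j)" for j
  proof -
    show "set (W j) = ?X j"
    proof (cases "j = Suc c")
      case True
      then show ?thesis using finB finP P(1) by (auto simp: W_def redistribute_def)
    qed (use finX[of j] in \<open>simp add: W_def\<close>)
    show "distinct (W j)" using finB finP by (simp add: W_def)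
  qed
  define S where "S = tab_of_lists W"
  have S: "S \<in> tabs" "col S = ?X" using tab_of_lists[OF X W] by (auto simp: S_def)
  have top: "(\<lambda>i. S (i, Suc c)) ` {..<k} = P"
  proof -
    have "(\<lambda>i. S (i, Suc c)) ` {..<k} = (!) (sorted_list_of_set P) ` {..<card P}"
      using k P(2) by (intro image_cong) (auto simp: S_def tab_of_lists_def W_def nth_append)
    then show ?thesis using finP by (simp add: nth_sorted_list_of_set_image)
  qed
  have E: "col S c \<union> B = col T c \<union> col T (Suc c)" and BS: "col S (Suc c) = B"
    using B(1) by (auto simp: S(2) redistribute_def)
  have h: "pair_fun a S c = pair_fun a T c"
    unfolding pair_fun_def S(2) using redistribute_redistribute[OF B(1)] by auto
  show "pair_fun a T c B = (-1) ^ k * (\<Sum>Q\<in>{Q. Q \<subseteq> (col T c \<union> col T (Suc c)) - B \<and> card Q = k}.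
      pair_fun a T c (B - P \<union> Q))"
    using g[OF S(1)] unfolding garnir_at_iff[OF a S(1) k] top BS E h .
qed

lemma exchange_relation_imp_garnir_at:
  assumes a: "column_alternating a" and T: "T \<in> tabs" and k: "k \<le> L (Suc c)"
    and h: "exchange_relation (col T c \<union> col T (Suc c)) (L (Suc c)) k (pair_fun a T c)"
  shows "garnir_at a T c k"
proof -
  have "(\<lambda>i. T (i, Suc c)) ` {..<k} \<subseteq> col T (Suc c)"
    using k by (auto simp: column_def)
  moreover have "card ((\<lambda>i. T (i, Suc c)) ` {..<k}) = k"
    using k T by (subst card_image) (auto simp: inj_on_def tab_eq_iff)
  ultimately show ?thesis
    using h card_col[OF T] unfolding garnir_at_iff[OF a T k] exchange_relation_def by blast
qed

lemma extension_sums_zero_imp_garnir_at: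
  fixes a :: "tableau \<Rightarrow> 'k::field_char_0"
  assumes "column_alternating a" "T \<in> tabs" "0 < k" "k \<le> L (Suc c)"
    and "extension_sums_zero (col T c \<union> col T (Suc c)) (L (Suc c)) (pair_fun a T c)"
  shows "garnir_at a T c k"
proof (rule exchange_relation_imp_garnir_at[OF assms(1,2,4)])
  have "finite (col T c \<union> col T (Suc c))" by (simp add: finite_col)
  then show "exchange_relation (col T c \<union> col T (Suc c)) (L (Suc c)) k (pair_fun a T c)"
    using assms(3,5) by (rule extension_sums_zero_imp_exchange_relation)
qed

text \<open>The disjunction reflects two routes: the eigenvalue argument for k < L c and the direct
  one for k = 1.\<close>

lemma garnir_at_imp_extension_sums_zero:
  fixes a :: "tableau \<Rightarrow> 'k::field_char_0"
  assumes a: "column_alternating a" and T: "T \<in> tabs" and k: "0 < k" "k \<le> L (Suc c)"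
    and "k < L c \<or> k = 1"
    and g: "\<And>S. S \<in> tabs \<Longrightarrow> garnir_at a S c k"
  shows "extension_sums_zero (col T c \<union> col T (Suc c)) (L (Suc c)) (pair_fun a T c)"
proof -
  let ?E = "col T c \<union> col T (Suc c)"
  have E: "finite ?E" "card ?E = L c + L (Suc c)"
    using card_pair[OF T] by (auto simp: finite_col)
  note er = garnir_at_imp_exchange_relation[OF a T k(2) g]
  show ?thesis
  proof (cases "k < L c")
    case True
    then show ?thesis using exchange_relation_imp_extension_sums_zero[OF E k True er] by simp
  next
    case False
    then have "k = 1" using assms by blast
    moreover have "0 < L c" using k L_Suc_le[of c] by linarith
    ultimately show ?thesis using exchange_relation_1_imp_extension_sums_zero[OF E] er by simp
  qed
qed

lemma garnir_at_all:
  fixes a :: "tableau \<Rightarrow> 'k::field_char_0"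
  assumes "column_alternating a" "T \<in> tabs" "0 < k" "k \<le> L (Suc c)" "k < L c \<or> k = 1"
    and "\<And>S. S \<in> tabs \<Longrightarrow> garnir_at a S c k"
    and "0 < j" "j \<le> L (Suc c)"
  shows "garnir_at a T c j"
  by (rule extension_sums_zero_imp_garnir_at[OF assms(1,2,7,8)
        garnir_at_imp_extension_sums_zero[OF assms(1-6)]])

end

section \<open>Straightening and standard polytabloids\<close>

lemma strict_mono_enumeration_unique:
  fixes f g :: "nat \<Rightarrow> nat"
  assumes f: "\<And>i k. i < k \<Longrightarrow> k < n \<Longrightarrow> f i < f k"
    and g: "\<And>i k. i < k \<Longrightarrow> k < n \<Longrightarrow> g i < g k"
    and eq: "f ` {..<n} = g ` {..<n}" and i: "i < n"
  shows "f i = g i"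
proof -
  have s: "sorted_wrt (<) (map h [0..<n])" if "\<And>i k. i < k \<Longrightarrow> k < n \<Longrightarrow> h i < h k" for h :: "nat \<Rightarrow> nat"
    using that by (auto simp: sorted_wrt_iff_nth_less)
  have "map f [0..<n] = map g [0..<n]"
    using s[OF f] s[OF g] eq
    by (intro sorted_distinct_set_unique) (auto simp: strict_sorted_iff atLeast0LessThan)
  then show ?thesis using i by (simp add: map_eq_conv)
qed

lemma finite_attains_max:
  fixes f :: "'a \<Rightarrow> 'b::linorder"
  assumes "finite N" "N \<noteq> {}"
  obtains x where "x \<in> N" "\<And>y. y \<in> N \<Longrightarrow> f y \<le> f x"
proof -
  have "Max (f ` N) \<in> f ` N" using assms by (intro Max_in) auto
  then obtain x where "x \<in> N" "f x = Max (f ` N)" by (metis imageE)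
  then show thesis using that assms(1) by (metis Max_ge finite_imageI imageI)
qed

context partition_shape
begin

section \<open>Standard tableaux and straightening\<close>

definition cols_increase :: "tableau \<Rightarrow> bool" where
  "cols_increase T \<longleftrightarrow> (\<forall>j i i'. i < i' \<longrightarrow> i' < L j \<longrightarrow> T (i, j) < T (i', j))"

definition standard :: "tableau set" where
  "standard = {T \<in> tabs. cols_increase T \<and> (\<forall>i j. i < L (Suc j) \<longrightarrow> T (i, j) < T (i, Suc j))}"

lemma sorted_tableau_exists:
  assumes T: "T \<in> tabs"
  obtains S where "S \<in> tabs" "col S = col T" "cols_increase S"
proof -
  define W where "W j = sorted_list_of_set (col T j)" for j
  have W: "set (W j) = col T j" "distinct (W j)" for j
    by (simp_all add: W_def finite_col)
  note S = tab_of_lists[OF column_sets_col[OF T] W]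
  have "cols_increase (tab_of_lists W)"
    unfolding cols_increase_def
  proof (intro allI impI)
    fix j i i' assume i: "i < i'" "i' < L j"
    have "sorted_wrt (<) (W j)" unfolding W_def by (rule strict_sorted_list_of_set)
    moreover have "length (W j) = L j" by (simp add: W_def card_col[OF T])
    ultimately show "tab_of_lists W (i, j) < tab_of_lists W (i', j)"
      using i by (simp add: tab_of_lists_def sorted_wrt_iff_nth_less)
  qed
  then show thesis using that S by blast
qed

text \<open>With powers of two a set having the larger maximum outweighs any set of smaller numbers.
  The factor j makes the weight grow when heavy entries move to the right.\<close>

definition column_weight :: "tableau \<Rightarrow> int" where
  "column_weight T = (\<Sum>j<length (conj_part ls). int j * (\<Sum>x\<in>col T j. 2 ^ x))"

text \<open>The change of weight is the weight of Q minus that of P. The entries of P are at most v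
  = T (i, c + 1), so together they weigh less than 2^(v + 1), while Q contains an entry above
  v.\<close>

lemma column_weight_garnir_exchange:
  assumes T: "T \<in> tabs" "cols_increase T" and i: "i < L (Suc c)" "T (i, Suc c) < T (i, c)"
    and A: "A \<subseteq> {0..<L c}" "card A = Suc i"
  shows "column_weight T < column_weight (garnir_exchange T c A)"
proof -
  define P where "P = (\<lambda>i. T (i, Suc c)) ` {..<card A}"
  define Q where "Q = (\<lambda>i. T (i, c)) ` A"
  let ?S = "garnir_exchange T c A"
  let ?w = "\<lambda>X::nat set. \<Sum>x\<in>X. 2 ^ x :: int"
  have finA: "finite A" using A finite_subset by blast
  have PQ: "P \<subseteq> col T (Suc c)" "Q \<subseteq> col T c" and fin: "finite P" "finite Q"
    using A i finA by (auto simp: P_def Q_def column_def)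
  have "card A \<le> L (Suc c)" using A i by simp
  then have colS: "col ?S = (col T)(c := col T c - Q \<union> P, Suc c := col T (Suc c) - P \<union> Q)"
    using garnir_exchange(3)[OF T(1) A(1)] by (simp add: P_def Q_def)
  have disj: "col T c \<inter> col T (Suc c) = {}" using col_disjoint[OF T(1)] by simp
  have w: "?w (X - Q' \<union> P') = ?w X - ?w Q' + ?w P'"
    if "finite X" "finite P'" "Q' \<subseteq> X" "P' \<inter> X = {}" for X P' Q'
    using that by (subst sum.union_disjoint) (auto simp: sum_diff)
  have wc: "?w (col ?S c) = ?w (col T c) - ?w Q + ?w P"
    using w[of "col T c" P Q] PQ fin disj by (auto simp: colS finite_col)
  have wSc: "?w (col ?S (Suc c)) = ?w (col T (Suc c)) - ?w P + ?w Q"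
    using w[of "col T (Suc c)" Q P] PQ fin disj by (auto simp: colS finite_col)
  have "Suc c < length (conj_part ls)" using i by (simp add: less_length_conj_part)
  have "column_weight ?S - column_weight T =
      (\<Sum>j<length (conj_part ls). int j * (?w (col ?S j) - ?w (col T j)))"
    by (simp add: column_weight_def right_diff_distrib flip: sum_subtractf)
  also have "\<dots> = (\<Sum>j\<in>{c, Suc c}. int j * (?w (col ?S j) - ?w (col T j)))"
    using \<open>Suc c < length (conj_part ls)\<close>
    by (intro sum.mono_neutral_right) (auto simp: colS)
  also have "\<dots> = int c * (?w (col ?S c) - ?w (col T c)) +
      int (Suc c) * (?w (col ?S (Suc c)) - ?w (col T (Suc c)))"
    by simp
  also have "\<dots> = ?w Q - ?w P"
    unfolding wc wSc by (simp add: algebra_simps)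
  finally have diff: "column_weight ?S - column_weight T = ?w Q - ?w P" .
  let ?v = "T (i, Suc c)"
  have "T (t, Suc c) \<le> ?v" if "t \<le> i" for t
    using T(2) that i(1) unfolding cols_increase_def by (metis le_neq_implies_less less_imp_le order_refl)
  then have "P \<subseteq> {..<Suc ?v}" using A by (auto simp: P_def less_Suc_eq_le)
  then have "?w P \<le> ?w {..<Suc ?v}" by (intro sum_mono2) auto
  also have "?w {..<Suc ?v} < 2 ^ Suc ?v"
  proof -
    have "?w {..<n} < 2 ^ n" for n by (induction n) auto
    then show ?thesis .
  qed
  also have "\<dots> \<le> ?w Q"
  proof -
    \<comment> \<open>Only i rows lie above row i, but A has i + 1 elements, so A reaches row i or
      below.\<close>
    have "\<not> A \<subseteq> {..<i}" using A card_mono[of "{..<i}" A] by auto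
    then obtain t where t: "t \<in> A" "i \<le> t" by force
    then have tL: "t < L c" using A(1) by auto
    have "T (i, c) \<le> T (t, c)"
      using T(2) t tL unfolding cols_increase_def by (metis le_neq_implies_less less_imp_le order_refl)
    then have "Suc ?v \<le> T (t, c)" using i(2) by simp
    then have "(2::int) ^ Suc ?v \<le> 2 ^ T (t, c)" by (intro power_increasing) auto
    also have "\<dots> \<le> ?w Q" using t fin by (intro member_le_sum) (auto simp: Q_def)
    finally show ?thesis .
  qed
  finally show ?thesis using diff by simp
qed

text \<open>Straightening, stated for functionals: a nonzero value at a tableau of maximal column weight
  would be forced to vanish by the Garnir relation at a row descent.\<close>
lemma zero_if_zero_on_standard:
  fixes a :: "tableau \<Rightarrow> 'k::comm_ring_1"
  assumes a: "column_alternating a"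
    and g: "\<And>T c k. T \<in> tabs \<Longrightarrow> 0 < k \<Longrightarrow> k \<le> L (Suc c) \<Longrightarrow> garnir_at a T c k"
    and std: "\<And>T. T \<in> standard \<Longrightarrow> a T = 0"
    and T: "T \<in> tabs"
  shows "a T = 0"
proof (rule ccontr)
  assume "a T \<noteq> 0"
  define N where "N = {S \<in> tabs. a S \<noteq> 0}"
  have N: "finite N" "N \<noteq> {}" using finite_tabs \<open>a T \<noteq> 0\<close> T by (auto simp: N_def)
  then obtain S where S: "S \<in> N" "\<And>U. U \<in> N \<Longrightarrow> column_weight U \<le> column_weight S"
    using finite_attains_max[OF N] by blast
  then have tabS: "S \<in> tabs" by (simp add: N_def)
  \<comment> \<open>Sorting the columns keeps the weight and changes the value only by a sign, so S'
    is again a maximal tableau with nonzero value.\<close>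
  obtain S' where S': "S' \<in> tabs" "col S' = col S" "cols_increase S'"
    using sorted_tableau_exists[OF tabS] by blast
  have "twist a S \<noteq> 0" using S(1) untwist[of a S] by (auto simp: N_def)
  then have "twist a S' \<noteq> 0" using twist_cong[OF a S'(1) tabS S'(2)] by simp
  then have aS': "a S' \<noteq> 0" by (auto simp: twist_def)
  have wS': "column_weight S' = column_weight S" by (simp add: column_weight_def S'(2))
  have "S' \<notin> standard" using std aS' by blast
  then obtain i c where i: "i < L (Suc c)" "\<not> S' (i, c) < S' (i, Suc c)"
    using S' by (auto simp: standard_def)
  then have "S' (i, Suc c) < S' (i, c)"
    using tab_eq_iff[OF S'(1), of i "Suc c" i c] L_Suc_le[of c] by (metis linorder_neqE_nat n_not_Suc_n order.strict_trans2)
  \<comment> \<open>Rows are counted from 0: the top i + 1 entries of the right column are those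
    down to and including the descent.\<close>
  have "a S' = (\<Sum>A\<in>{A. A \<subseteq> {0..<L c} \<and> card A = Suc i}. a (garnir_exchange S' c A))"
    using g[OF S'(1), of "Suc i" c] i by (simp add: garnir_at_def)
  also have "\<dots> = 0"
  proof (rule sum.neutral, rule ballI)
    fix A assume "A \<in> {A. A \<subseteq> {0..<L c} \<and> card A = Suc i}"
    then have A: "A \<subseteq> {0..<L c}" "card A = Suc i" by auto
    have "column_weight S' < column_weight (garnir_exchange S' c A)"
      by (rule column_weight_garnir_exchange[OF S'(1,3) i(1) _ A]) fact
    then have "garnir_exchange S' c A \<notin> N" using S(2) wS' by fastforce
    moreover have "garnir_exchange S' c A \<in> tabs"
      using garnir_exchange(1)[OF S'(1) A(1)] A(2) i(1) by simp
    ultimately show "a (garnir_exchange S' c A) = 0" by (simp add: N_def)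
  qed
  finally show False using aS' by simp
qed

section \<open>Polytabloids and their Garnir relations\<close>

lemma mem_tabloid: "(x, i) \<in> tabloid ls T \<longleftrightarrow> (\<exists>j. i < L j \<and> x = T (i, j))"
  by (auto simp: tabloid_def diagram_iff)

lemma tabloid_perm: "tabloid ls (\<sigma> \<circ> T) = map_prod \<sigma> id ` tabloid ls T"
  by (force simp: tabloid_def)

lemma col_stab_iff:
  assumes T: "T \<in> tabs"
  shows "\<sigma> \<in> col_stab ls T \<longleftrightarrow> \<sigma> permutes {1..r} \<and> (\<forall>j. \<sigma> ` col T j = col T j)"
proof (cases "\<sigma> permutes {1..r}")
  case True
  have mem: "x \<in> col T j \<longleftrightarrow> (\<exists>i'. (i', j) \<in> Y \<and> x = T (i', j))" for x j
    unfolding column_def diagram_iff by blast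
  have "(\<forall>(i, j)\<in>Y. \<exists>i'. (i', j) \<in> Y \<and> \<sigma> (T (i, j)) = T (i', j)) \<longleftrightarrow> (\<forall>j. \<sigma> ` col T j \<subseteq> col T j)"
    unfolding image_subset_iff Ball_def mem split_paired_All prod.case by blast
  moreover have "\<sigma> ` col T j \<subseteq> col T j \<longleftrightarrow> \<sigma> ` col T j = col T j" for j
    using endo_inj_surj[OF finite_col _ inj_on_subset[OF permutes_inj[OF True] subset_UNIV]] by blast
  ultimately show ?thesis using True by (simp add: col_stab_def)
qed (simp add: col_stab_def)

lemma col_stab_permutes: "\<sigma> \<in> col_stab ls T \<Longrightarrow> \<sigma> permutes {1..r}"
  by (simp add: col_stab_def)

lemma finite_col_stab: "finite (col_stab ls T)"
  by (rule finite_subset[OF _ finite_permutations[of "{1..r}"]]) (auto simp: col_stab_def)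

lemma map_prod_inv_image:
  assumes "g permutes S"
  shows "map_prod g id ` x = y \<longleftrightarrow> x = map_prod (inv g) id ` y"
proof -
  have "map_prod (inv g) id ` map_prod g id ` x = x" for x
    using permutes_inverses[OF assms] by (simp add: image_image map_prod_def case_prod_unfold)
  moreover have "map_prod g id ` map_prod (inv g) id ` y = y" for y
    using permutes_inverses[OF assms] by (simp add: image_image map_prod_def case_prod_unfold)
  ultimately show ?thesis by metis
qed

text \<open>Conjugation by g carries the column stabilizer of T to that of
  \<open>g \<circ> T\<close> and preserves signs.\<close>

lemma polytabloid_perm:
  assumes T: "T \<in> tabs" and g: "g permutes {1..r}"
  shows "(polytabloid ls (g \<circ> T) :: _ \<Rightarrow> 'k::comm_ring_1) \<tau> =
    polytabloid ls T (map_prod (inv g) id ` \<tau>)"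
proof -
  note gi = permutes_inverses[OF g] permutes_inv_o[OF g]
  have pg: "permutation g" using g permutation_permutes by blast
  have "(\<Sum>\<sigma>\<in>col_stab ls T. of_int (sign \<sigma>) * delta (tabloid ls (\<sigma> \<circ> T)) (map_prod (inv g) id ` \<tau>)) =
    (\<Sum>\<sigma>\<in>col_stab ls (g \<circ> T). of_int (sign \<sigma>) * delta (tabloid ls (\<sigma> \<circ> (g \<circ> T))) \<tau> :: 'k)"
  proof (rule sum.reindex_bij_witness[where j = "\<lambda>\<sigma>. g \<circ> \<sigma> \<circ> inv g" and i = "\<lambda>\<sigma>. inv g \<circ> \<sigma> \<circ> g"])
    fix \<sigma> assume \<sigma>: "\<sigma> \<in> col_stab ls T"
    show "inv g \<circ> (g \<circ> \<sigma> \<circ> inv g) \<circ> g = \<sigma>"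
      by (simp add: fun_eq_iff gi)
    have p\<sigma>: "\<sigma> permutes {1..r}" by (rule col_stab_permutes[OF \<sigma>])
    have "(g \<circ> \<sigma> \<circ> inv g) ` col (g \<circ> T) j = col (g \<circ> T) j" for j
    proof -
      have "(g \<circ> \<sigma> \<circ> inv g) ` g ` col T j = g ` \<sigma> ` col T j"
        by (simp add: image_image gi)
      then show ?thesis using \<sigma> by (simp add: col_perm col_stab_iff[OF T])
    qed
    moreover have "g \<circ> \<sigma> \<circ> inv g permutes {1..r}"
      using g p\<sigma> by (intro permutes_compose permutes_inv)
    ultimately show "g \<circ> \<sigma> \<circ> inv g \<in> col_stab ls (g \<circ> T)"
      by (simp add: col_stab_iff[OF perm_tab[OF T g]])
    have ps: "permutation \<sigma>" using p\<sigma> permutation_permutes by blast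
    have "sign (g \<circ> \<sigma> \<circ> inv g) = sign \<sigma>"
      using pg ps by (simp add: sign_compose permutation_compose permutation_inverse sign_inverse mult.commute sign_idempotent)
    moreover have "g \<circ> \<sigma> \<circ> inv g \<circ> (g \<circ> T) = g \<circ> (\<sigma> \<circ> T)"
      by (simp add: fun_eq_iff gi)
    moreover have "delta (tabloid ls (g \<circ> (\<sigma> \<circ> T))) \<tau> =
        (delta (tabloid ls (\<sigma> \<circ> T)) (map_prod (inv g) id ` \<tau>) :: 'k)"
      unfolding tabloid_perm[of g "\<sigma> \<circ> T"] delta_def
      using map_prod_inv_image[OF g, of "tabloid ls (\<sigma> \<circ> T)" \<tau>] by auto
    ultimately show "of_int (sign (g \<circ> \<sigma> \<circ> inv g)) * delta (tabloid ls (g \<circ> \<sigma> \<circ> inv g \<circ> (g \<circ> T))) \<tau> =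
        (of_int (sign \<sigma>) * delta (tabloid ls (\<sigma> \<circ> T)) (map_prod (inv g) id ` \<tau>) :: 'k)"
      by (simp only:)
  next
    fix \<sigma> assume \<sigma>: "\<sigma> \<in> col_stab ls (g \<circ> T)"
    show "g \<circ> (inv g \<circ> \<sigma> \<circ> g) \<circ> inv g = \<sigma>"
      by (simp add: fun_eq_iff gi)
    have p\<sigma>: "\<sigma> permutes {1..r}" by (rule col_stab_permutes[OF \<sigma>])
    have "(inv g \<circ> \<sigma> \<circ> g) ` col T j = col T j" for j
    proof -
      have "\<sigma> ` g ` col T j = g ` col T j"
        using \<sigma> by (simp add: col_stab_iff[OF perm_tab[OF T g]] col_perm)
      then have "inv g ` \<sigma> ` g ` col T j = inv g ` g ` col T j" by simp
      then show ?thesis by (simp add: image_image gi)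
    qed
    moreover have "inv g \<circ> \<sigma> \<circ> g permutes {1..r}"
      using g p\<sigma> by (intro permutes_compose permutes_inv)
    ultimately show "inv g \<circ> \<sigma> \<circ> g \<in> col_stab ls T"
      by (simp add: col_stab_iff[OF T])
  qed
  then show ?thesis by (simp add: polytabloid_def)
qed

text \<open>Right multiplication by g permutes the column stabilizer, and each sign changes by that
  of g.\<close>

lemma polytabloid_col_stab:
  assumes T: "T \<in> tabs" and g: "g \<in> col_stab ls T"
  shows "(polytabloid ls (g \<circ> T) :: _ \<Rightarrow> 'k::comm_ring_1) \<tau> = of_int (sign g) * polytabloid ls T \<tau>"
proof -
  have pg: "g permutes {1..r}" by (rule col_stab_permutes[OF g])
  note gi = permutes_inverses[OF pg]
  have perm_g: "permutation g" using pg permutation_permutes by blast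
  have gcol: "g ` col T j = col T j" for j using g by (simp add: col_stab_iff[OF T])
  have igcol: "inv g ` col T j = col T j" for j
  proof -
    have "inv g ` g ` col T j = col T j" by (simp add: image_image gi)
    then show ?thesis by (simp add: gcol)
  qed
  have eq: "col_stab ls (g \<circ> T) = col_stab ls T"
    by (rule set_eqI) (simp add: col_stab_iff[OF T] col_stab_iff[OF perm_tab[OF T pg]] col_perm gcol)
  have "(\<Sum>\<sigma>\<in>col_stab ls T. of_int (sign \<sigma>) * delta (tabloid ls (\<sigma> \<circ> (g \<circ> T))) \<tau> :: 'k) =
    (\<Sum>\<sigma>\<in>col_stab ls T. of_int (sign g) * (of_int (sign \<sigma>) * delta (tabloid ls (\<sigma> \<circ> T)) \<tau>))"
  proof (rule sum.reindex_bij_witness[where j = "\<lambda>\<sigma>. \<sigma> \<circ> g" and i = "\<lambda>\<sigma>. \<sigma> \<circ> inv g"])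
    fix \<sigma> assume \<sigma>: "\<sigma> \<in> col_stab ls T"
    have p\<sigma>: "\<sigma> permutes {1..r}" by (rule col_stab_permutes[OF \<sigma>])
    have perm_\<sigma>: "permutation \<sigma>" using p\<sigma> permutation_permutes by blast
    have \<sigma>col: "\<sigma> ` col T j = col T j" for j using \<sigma> by (simp add: col_stab_iff[OF T])
    show "\<sigma> \<circ> g \<circ> inv g = \<sigma>" "\<sigma> \<circ> inv g \<circ> g = \<sigma>" by (simp_all add: fun_eq_iff gi)
    have "(\<sigma> \<circ> g) ` col T j = col T j" for j
      unfolding image_comp[symmetric] gcol by (rule \<sigma>col)
    then show "\<sigma> \<circ> g \<in> col_stab ls T"
      unfolding col_stab_iff[OF T] using permutes_compose[OF pg p\<sigma>] by blast
    have "(\<sigma> \<circ> inv g) ` col T j = col T j" for j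
      unfolding image_comp[symmetric] igcol by (rule \<sigma>col)
    then show "\<sigma> \<circ> inv g \<in> col_stab ls T"
      unfolding col_stab_iff[OF T] using permutes_compose[OF permutes_inv[OF pg] p\<sigma>] by blast
    have "sign g * sign (\<sigma> \<circ> g) = sign \<sigma>"
      using perm_g perm_\<sigma> by (simp add: sign_compose mult.left_commute sign_idempotent)
    then have "of_int (sign g) * of_int (sign (\<sigma> \<circ> g)) = (of_int (sign \<sigma>) :: 'k)"
      by (metis of_int_mult)
    then show "of_int (sign g) * (of_int (sign (\<sigma> \<circ> g)) * delta (tabloid ls (\<sigma> \<circ> g \<circ> T)) \<tau>) =
      (of_int (sign \<sigma>) * delta (tabloid ls (\<sigma> \<circ> (g \<circ> T))) \<tau> :: 'k)"
      by (simp only: comp_assoc mult.assoc[symmetric])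
  qed
  then show ?thesis by (simp add: polytabloid_def eq sum_distrib_left)
qed

lemma transpose_col_stab:
  assumes T: "T \<in> tabs" and uv: "u \<in> col T c" "v \<in> col T c"
  shows "transpose u v \<in> col_stab ls T"
proof -
  have "transpose u v ` col T j = col T j" for j
  proof (cases "j = c")
    case False
    then have "u \<notin> col T j" "v \<notin> col T j" using uv col_disjoint[OF T] by blast+
    then show ?thesis by (simp add: transpose_image_eq)
  qed (use uv in \<open>simp add: transpose_image_eq\<close>)
  moreover have "transpose u v permutes {1..r}"
    using uv col_subset[OF T] by (intro permutes_swap_id) blast+
  ultimately show ?thesis by (simp add: col_stab_iff[OF T])
qed

lemma column_alternating_polytabloid:
  "column_alternating (\<lambda>T. polytabloid ls T \<tau> :: 'k::comm_ring_1)"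
  unfolding column_alternating_def
proof (intro ballI allI impI)
  fix T j i i' assume T: "T \<in> tabs" and i: "i < L j" "i' < L j" "i \<noteq> i'"
  have "T (i, j) \<noteq> T (i', j)" using T i by (simp add: tab_eq_iff)
  then show "polytabloid ls (transpose (T (i, j)) (T (i', j)) \<circ> T) \<tau> = - (polytabloid ls T \<tau> :: 'k)"
    using polytabloid_col_stab[OF T transpose_col_stab[OF T col_memI[OF i(1)] col_memI[OF i(2)]]]
    by (simp add: sign_swap_id)
qed

lemma polytabloid_nonzero:
  assumes T: "T \<in> tabs" and nz: "(polytabloid ls T \<tau> :: 'k::comm_ring_1) \<noteq> 0"
  obtains U where "U \<in> tabs" "col U = col T" "\<tau> = tabloid ls U"
proof -
  obtain \<sigma> where \<sigma>: "\<sigma> \<in> col_stab ls T" "delta (tabloid ls (\<sigma> \<circ> T)) \<tau> \<noteq> (0 :: 'k)"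
    using nz unfolding polytabloid_def by (metis (no_types, lifting) mult_zero_right sum.neutral)
  then have "\<tau> = tabloid ls (\<sigma> \<circ> T)" by (auto simp: delta_def split: if_splits)
  moreover have "\<sigma> \<circ> T \<in> tabs" by (rule perm_tab[OF T col_stab_permutes[OF \<sigma>(1)]])
  moreover have "col (\<sigma> \<circ> T) = col T" using \<sigma>(1) by (simp add: fun_eq_iff col_perm col_stab_iff[OF T])
  ultimately show thesis using that by blast
qed

text \<open>Fix the tabloid. If the term of u is nonzero, the tabloid comes from a tableau U with u
  in column c + 1; let v be the left neighbour of u in U. The transposition g of u and v preserves
  the tabloid, since both lie in one row. It makes the terms of u and v cancel, and every other term
  vanishes because u and v then share column c.\<close>

lemma extension_sums_zero_polytabloid:
  assumes T: "T \<in> tabs"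
  shows "extension_sums_zero (col T c \<union> col T (Suc c)) (L (Suc c))
    (pair_fun (\<lambda>T. polytabloid ls T \<tau> :: 'k::field_char_0) T c)"
proof -
  define E where "E = col T c \<union> col T (Suc c)"
  define a where "a T = (polytabloid ls T \<tau> :: 'k)" for T
  have alt: "column_alternating a"
    using column_alternating_polytabloid[of \<tau>] by (simp add: a_def[abs_def])
  define h where "h = pair_fun a T c"
  have "(\<Sum>y\<in>E - R. h (insert y R)) = 0" if R: "R \<subseteq> E" "Suc (card R) = L (Suc c)" for R
  proof (cases "\<forall>y\<in>E - R. h (insert y R) = 0")
    case False
    then obtain u where u: "u \<in> E - R" "h (insert u R) \<noteq> 0" by blast
    have finE: "finite E" by (simp add: E_def finite_col)
    have finR: "finite R" using R finE finite_subset by blast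
    have ex: "\<exists>S\<in>tabs. col S = redistribute (col T) c (insert y R) \<and> h (insert y R) = twist a S"
      if y: "y \<in> E - R" for y
    proof -
      have B: "insert y R \<subseteq> col T c \<union> col T (Suc c)" "card (insert y R) = L (Suc c)"
        using y R finR by (auto simp: E_def)
      have cs: "column_sets (redistribute (col T) c (insert y R))"
        by (rule column_sets_redistribute[OF T B])
      define W where "W j = sorted_list_of_set (redistribute (col T) c (insert y R) j)" for j
      have "set (W j) = redistribute (col T) c (insert y R) j" "distinct (W j)" for j
        using cs by (simp_all add: W_def column_sets_def)
      from tab_of_lists[OF cs this] show ?thesis
        using pair_fun_eq_twist[OF alt] unfolding h_def by blast
    qed
    obtain S where S: "S \<in> tabs" "col S = redistribute (col T) c (insert u R)"
      "h (insert u R) = twist a S" using ex[OF u(1)] by blast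
    have colS: "col S (Suc c) = insert u R" "col S c = E - insert u R"
      by (simp_all add: S(2) redistribute_def E_def)
    have "a S \<noteq> 0" using u(2) S(3) by (auto simp: twist_def)
    then obtain U where U: "U \<in> tabs" "col U = col S" "\<tau> = tabloid ls U"
      using polytabloid_nonzero[OF S(1)] unfolding a_def by metis
    have "u \<in> col U (Suc c)" using U(2) colS by simp
    then obtain i where i: "i < L (Suc c)" "u = U (i, Suc c)" by (auto simp: column_def)
    \<comment> \<open>The neighbour exists because column c is at least as long as column c +
      1.\<close>
    define v where "v = U (i, c)"
    have iL: "i < L c" using i(1) L_Suc_le[of c] by simp
    have "v \<in> col U c" unfolding v_def by (rule col_memI[OF iL])
    then have v: "v \<in> E - R" "v \<noteq> u" using U(2) colS by auto
    define g where "g = transpose u v"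
    have gg: "inv g = g" by (simp add: g_def)
    have pg: "g permutes {1..r}"
    proof -
      have "E \<subseteq> {1..r}" using col_subset[OF T] by (simp add: E_def)
      then show ?thesis unfolding g_def using u(1) v(1) by (intro permutes_swap_id) blast+
    qed
    have row: "(x, k) \<in> \<tau> \<Longrightarrow> (g x, k) \<in> \<tau>" for x k
    proof -
      assume xk: "(x, k) \<in> \<tau>"
      have uv: "(u, i) \<in> \<tau>" "(v, i) \<in> \<tau>"
        using i iL by (auto simp: U(3) mem_tabloid v_def)
      have "k = i" if "x = u \<or> x = v"
      proof -
        obtain j where "k < L j" "x = U (k, j)" using xk by (auto simp: U(3) mem_tabloid)
        then show ?thesis using that i iL U(1) by (auto simp: v_def tab_eq_iff)
      qed
      then show "(g x, k) \<in> \<tau>"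
        using xk uv by (cases "x = u"; cases "x = v") (auto simp: g_def)
    qed
    have "map_prod (inv g) id ` \<tau> = \<tau>"
    proof (intro equalityI subsetI)
      fix z assume "z \<in> map_prod (inv g) id ` \<tau>"
      then show "z \<in> \<tau>" using row by (auto simp: gg)
    next
      fix z assume z: "z \<in> \<tau>"
      obtain x k where xk: "z = (x, k)" by fastforce
      have "z = map_prod (inv g) id (g x, k)" by (simp add: gg xk g_def)
      moreover have "(g x, k) \<in> \<tau>" using row z xk by simp
      ultimately show "z \<in> map_prod (inv g) id ` \<tau>" by (rule image_eqI)
    qed
    then have inv: "a (g \<circ> S') = a S'" if "S' \<in> tabs" for S'
      using polytabloid_perm[OF that pg, of \<tau>] by (simp add: a_def)
    have other: "h (insert y R) = 0" if y: "y \<in> E - R - {u} - {v}" for y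
    proof -
      obtain S' where S': "S' \<in> tabs" "col S' = redistribute (col T) c (insert y R)"
        "h (insert y R) = twist a S'" using ex y by blast
      have "col S' c = E - insert y R" by (simp add: S'(2) redistribute_def E_def)
      then have "u \<in> col S' c" "v \<in> col S' c" using u v y by auto
      then have "g \<in> col_stab ls S'" unfolding g_def by (rule transpose_col_stab[OF S'(1)])
      \<comment> \<open>The coefficient is alternating in u and v as members of one column, yet
        invariant under g by \<open>inv\<close>; in characteristic zero it must vanish.\<close>
      then have "a (g \<circ> S') = - a S'"
        using polytabloid_col_stab[OF S'(1), of g \<tau>, where 'k = 'k] v(2)
        by (simp add: a_def g_def sign_swap_id)
      then have "a S' = - a S'" using inv[OF S'(1)] by simp
      then have "a S' = 0" by simp
      then show ?thesis using S'(3) by (simp add: twist_def)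
    qed
    have "col (g \<circ> S) = redistribute (col T) c (insert v R)"
    proof
      fix j
      have "g ` X = X" if "u \<notin> X" "v \<notin> X" for X
        using that by (simp add: g_def transpose_image_eq)
      note gX = this
      consider "j = c" | "j = Suc c" | "j \<noteq> c" "j \<noteq> Suc c" by blast
      then show "col (g \<circ> S) j = redistribute (col T) c (insert v R) j"
      proof cases
        case 1
        have "E - insert u R = insert v (E - R - {u} - {v})" using u v by auto
        then have "g ` (E - insert u R) = insert u (E - R - {u} - {v})"
          using gX[of "E - R - {u} - {v}"] by (simp only: image_insert) (simp add: g_def)
        also have "\<dots> = E - insert v R" using u v by auto
        finally show ?thesis using 1 by (simp add: col_perm colS redistribute_def E_def)
      next
        case 2
        have "g ` insert u R = insert v R"
          using gX[of R] u v by (simp only: image_insert) (simp add: g_def)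
        then show ?thesis using 2 by (simp add: col_perm colS redistribute_def)
      next
        case 3
        have "u \<notin> col T j" "v \<notin> col T j"
          using u v col_disjoint[OF T 3(1)] col_disjoint[OF T 3(2)] by (auto simp: E_def)
        then show ?thesis using 3 gX by (simp add: col_perm S(2) redistribute_def)
      qed
    qed
    then have "h (insert v R) = twist a (g \<circ> S)"
      unfolding h_def by (rule pair_fun_eq_twist[OF alt perm_tab[OF S(1) pg]])
    also have "\<dots> = - twist a S"
      using v(2) by (simp add: twist_def inv[OF S(1)] tab_sign_perm[OF S(1) pg])
        (simp add: g_def sign_swap_id)
    finally have "h (insert u R) + h (insert v R) = 0" using S(3) by simp
    moreover have "(\<Sum>y\<in>E - R. h (insert y R)) =
        h (insert u R) + (h (insert v R) + (\<Sum>y\<in>E - R - {u} - {v}. h (insert y R)))"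
      using u v finE by (simp add: sum.remove[of "E - R" u] sum.remove[of "E - R - {u}" v])
    moreover have "(\<Sum>y\<in>E - R - {u} - {v}. h (insert y R)) = 0"
      using other by (intro sum.neutral) blast
    ultimately show ?thesis by simp
  qed simp
  then show ?thesis
    unfolding extension_sums_zero_def E_def h_def a_def[abs_def] by blast
qed

lemma garnir_at_polytabloid:
  assumes "T \<in> tabs" "0 < k" "k \<le> L (Suc c)"
  shows "garnir_at (\<lambda>T. polytabloid ls T \<tau> :: 'k::field_char_0) T c k"
  by (rule extension_sums_zero_imp_garnir_at[OF column_alternating_polytabloid assms
        extension_sums_zero_polytabloid[OF assms(1)]])

text \<open>A numerical substitute for the dominance order on tabloids: it depends only on the
  tabloid and grows when large entries move down.\<close>

definition row_weight :: "tableau \<Rightarrow> nat" where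
  "row_weight T = (\<Sum>p\<in>Y. fst p * T p)"

lemma row_weight_tabloid:
  assumes "T \<in> tabs" "S \<in> tabs" "tabloid ls T = tabloid ls S"
  shows "row_weight T = row_weight S"
proof -
  have "row_weight T = (\<Sum>(x, i)\<in>tabloid ls T. i * x)" if T: "T \<in> tabs" for T
  proof -
    have "tabloid ls T = (\<lambda>p. (T p, fst p)) ` Y" by (force simp: tabloid_def)
    moreover have "inj_on (\<lambda>p. (T p, fst p)) Y" using tab_inj[OF T] by (auto simp: inj_on_def)
    ultimately show ?thesis by (simp add: sum.reindex row_weight_def)
  qed
  then show ?thesis using assms by simp
qed

lemma cols_increase_unique:
  assumes "T \<in> tabs" "S \<in> tabs" "cols_increase T" "cols_increase S" "col T = col S"
  shows "T = S"
proof
  fix p :: "nat \<times> nat"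
  obtain i j where p: "p = (i, j)" by fastforce
  show "T p = S p"
  proof (cases "p \<in> Y")
    case True
    then have i: "i < L j" by (simp add: p diagram_iff)
    have "(\<lambda>i. T (i, j)) ` {..<L j} = (\<lambda>i. S (i, j)) ` {..<L j}"
      using fun_cong[OF assms(5), of j] by (simp add: column_def)
    then show ?thesis unfolding p using assms(3,4) i
      by (intro strict_mono_enumeration_unique[where f = "\<lambda>i. T (i, j)" and g = "\<lambda>i. S (i, j)"])
        (auto simp: cols_increase_def)
  next
    case False
    then show ?thesis using assms(1,2) by (simp add: tab_outside)
  qed
qed

text \<open>Rearrangement inequality: a maximiser of the row weight among the tableaux with the columns
  of \<open>T\<close> has no column descent, hence is \<open>T\<close>.\<close>
lemma row_weight_less:
  assumes T: "T \<in> tabs" "cols_increase T" and U: "U \<in> tabs" "col U = col T" "U \<noteq> T"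
  shows "row_weight U < row_weight T"
proof -
  define N where "N = {S \<in> tabs. col S = col T}"
  have N: "finite N" "N \<noteq> {}" using finite_tabs T by (auto simp: N_def)
  obtain S where S: "S \<in> N" "\<And>U. U \<in> N \<Longrightarrow> row_weight U \<le> row_weight S"
    using finite_attains_max[OF N] by blast
  have max_inc: "cols_increase S"
    if S: "S \<in> N" "\<And>U. U \<in> N \<Longrightarrow> row_weight U \<le> row_weight S" for S
  proof (rule ccontr)
    assume "\<not> cols_increase S"
    then obtain j i i' where i: "i < i'" "i' < L j" "\<not> S (i, j) < S (i', j)"
      by (auto simp: cols_increase_def)
    have tS: "S \<in> tabs" "col S = col T" using S(1) by (auto simp: N_def)
    have iL: "i < L j" using i by simp
    have "S (i, j) \<noteq> S (i', j)" using i iL tab_eq_iff[OF tS(1), of i j i' j] by simp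
    then have lt: "S (i', j) < S (i, j)" using i(3) by simp
    let ?g = "transpose (S (i, j)) (S (i', j))"
    have gcs: "?g \<in> col_stab ls S"
      by (rule transpose_col_stab[OF tS(1) col_memI[OF iL] col_memI[OF i(2)]])
    have "?g \<circ> S \<in> tabs" by (rule perm_tab[OF tS(1) col_stab_permutes[OF gcs]])
    moreover have "col (?g \<circ> S) = col T"
      using gcs tS by (simp add: fun_eq_iff col_perm col_stab_iff)
    ultimately have "?g \<circ> S \<in> N" by (simp add: N_def)
    have Yi: "(i, j) \<in> Y" "(i', j) \<in> Y" "(i, j) \<noteq> (i', j)" using i iL by (auto simp: diagram_iff)
    have upd: "?g \<circ> S = S((i, j) := S (i', j), (i', j) := S (i, j))"
      by (rule swap_eq_transpose[OF tS(1) Yi(1,2), symmetric])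
    let ?Z = "Y - {(i, j)} - {(i', j)}"
    have split: "row_weight V = i * V (i, j) + (i' * V (i', j) + (\<Sum>p\<in>?Z. fst p * V p))" for V
      unfolding row_weight_def using Yi finite_diagram
      by (simp add: sum.remove[of Y "(i, j)"] sum.remove[of "Y - {(i, j)}" "(i', j)"])
    have "(\<Sum>p\<in>?Z. fst p * (?g \<circ> S) p) = (\<Sum>p\<in>?Z. fst p * S p)"
      unfolding upd by (intro sum.cong) auto
    then have "row_weight (?g \<circ> S) =
        i * S (i', j) + (i' * S (i, j) + (\<Sum>p\<in>?Z. fst p * S p))"
      unfolding split by simp
    \<comment> \<open>The gain is the product of the row distance and the difference of the entries;
      both are written as successors to avoid subtraction of naturals.\<close>
    moreover have "i * S (i, j) + i' * S (i', j) < i * S (i', j) + i' * S (i, j)"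
    proof -
      obtain d where d: "i' = i + Suc d" using i(1) less_iff_Suc_add by auto
      obtain e where e: "S (i, j) = S (i', j) + Suc e" using lt less_iff_Suc_add by auto
      show ?thesis unfolding d e by (simp add: algebra_simps)
    qed
    ultimately have "row_weight S < row_weight (?g \<circ> S)"
      using split[of S] by linarith
    then show False using S(2)[OF \<open>?g \<circ> S \<in> N\<close>] by simp
  qed
  have uniq: "S' = T" if "S' \<in> N" "\<And>U. U \<in> N \<Longrightarrow> row_weight U \<le> row_weight S'" for S'
    using cols_increase_unique[of S' T] max_inc[OF that] that(1) T by (simp add: N_def)
  have "S = T" using uniq S by blast
  have UN: "U \<in> N" using U by (simp add: N_def)
  have "row_weight U \<noteq> row_weight T"
    using uniq[OF UN] S(2) U(3) \<open>S = T\<close> by metis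
  then show ?thesis using S(2)[OF UN] \<open>S = T\<close> by simp
qed

text \<open>The tabloid determines each row as a set, and the rows of a standard tableau
  increase.\<close>

lemma standard_tabloid_unique:
  assumes T: "T \<in> standard" and S: "S \<in> standard" and eq: "tabloid ls T = tabloid ls S"
  shows "T = S"
proof
  have row: "V (i, j) < V (i, j')" if "V \<in> standard" "j < j'" "i < L j'" for V i j j'
    using that(2,3)
  proof (induction j')
    case (Suc j')
    have "i < L j'" using Suc.prems L_Suc_le[of j'] by simp
    have step: "V (i, j') < V (i, Suc j')" using that(1) Suc.prems by (simp add: standard_def)
    show ?case
    proof (cases "j = j'")
      case False
      then show ?thesis using Suc.IH[OF _ \<open>i < L j'\<close>] Suc.prems step by simp
    qed (use step in simp)
  qed simp
  fix p :: "nat \<times> nat"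
  obtain i j where p: "p = (i, j)" by fastforce
  show "T p = S p"
  proof (cases "p \<in> Y")
    case True
    have Lj: "i < L j' \<longleftrightarrow> j' < ls ! i" for j'
      using True unfolding p by (auto simp: diagram_iff[symmetric] young_diagram_def)
    have rows: "(\<lambda>j. V (i, j)) ` {..<ls ! i} = {x. (x, i) \<in> tabloid ls V}" for V
      by (auto simp: mem_tabloid Lj)
    have "T (i, j) = S (i, j)"
    proof (rule strict_mono_enumeration_unique[where f = "\<lambda>j. T (i, j)" and g = "\<lambda>j. S (i, j)"])
      show "(\<lambda>j. T (i, j)) ` {..<ls ! i} = (\<lambda>j. S (i, j)) ` {..<ls ! i}" by (simp only: rows eq)
      show "j < ls ! i" using True p Lj by (simp add: diagram_iff)
    qed (use row[OF T] row[OF S] Lj in auto)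
    then show ?thesis by (simp add: p)
  next
    case False
    then show ?thesis using T S by (simp add: standard_def tab_outside)
  qed
qed

text \<open>Every column permutation other than the identity lowers the row weight and hence changes
  the tabloid, so only the identity contributes.\<close>

lemma polytabloid_self:
  assumes T: "T \<in> tabs" "cols_increase T"
  shows "polytabloid ls T (tabloid ls T) = (1 :: 'k::comm_ring_1)"
proof -
  have "(\<Sum>\<sigma>\<in>col_stab ls T. of_int (sign \<sigma>) * delta (tabloid ls (\<sigma> \<circ> T)) (tabloid ls T)) =
    (\<Sum>\<sigma>\<in>{id}. of_int (sign \<sigma>) * delta (tabloid ls (\<sigma> \<circ> T)) (tabloid ls T) :: 'k)"
  proof (rule sum.mono_neutral_right)
    show "finite (col_stab ls T)" by (rule finite_col_stab)
    show "{id} \<subseteq> col_stab ls T" by (simp add: col_stab_iff[OF T(1)] permutes_id)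
    show "\<forall>\<sigma>\<in>col_stab ls T - {id}. of_int (sign \<sigma>) * delta (tabloid ls (\<sigma> \<circ> T)) (tabloid ls T) = (0 :: 'k)"
    proof
      fix \<sigma> assume \<sigma>: "\<sigma> \<in> col_stab ls T - {id}"
      then have p: "\<sigma> permutes {1..r}" using col_stab_permutes[of \<sigma> T] by blast
      have tab: "\<sigma> \<circ> T \<in> tabs" by (rule perm_tab[OF T(1) p])
      have col: "col (\<sigma> \<circ> T) = col T" using \<sigma> by (simp add: fun_eq_iff col_perm col_stab_iff[OF T(1)])
      have "\<sigma> \<circ> T \<noteq> T"
      proof
        assume eq: "\<sigma> \<circ> T = T"
        have "\<sigma> x = x" for x
        proof (cases "x \<in> {1..r}")
          case True
          then obtain q where "x = T q" using tab_image[OF T(1)] by blast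
          then show ?thesis using fun_cong[OF eq, of q] by simp
        qed (use p in \<open>simp add: permutes_not_in\<close>)
        then show False using \<sigma> by (simp add: fun_eq_iff)
      qed
      then have "row_weight (\<sigma> \<circ> T) < row_weight T" by (rule row_weight_less[OF T tab col])
      then have "tabloid ls (\<sigma> \<circ> T) \<noteq> tabloid ls T" using row_weight_tabloid[OF tab T(1)] by auto
      then show "of_int (sign \<sigma>) * delta (tabloid ls (\<sigma> \<circ> T)) (tabloid ls T) = (0 :: 'k)"
        by (auto simp: delta_def)
    qed
  qed
  then show ?thesis by (simp add: polytabloid_def delta_def sign_id)
qed

text \<open>With \<open>polytabloid_self\<close> this makes the matrix of standard polytabloids
  against standard tabloids unitriangular with respect to the row weight.\<close>

lemma polytabloid_triangular:
  assumes T: "T \<in> standard" and S: "S \<in> standard"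
    and nz: "polytabloid ls T (tabloid ls S) \<noteq> (0 :: 'k::comm_ring_1)"
  shows "S = T \<or> row_weight S < row_weight T"
proof -
  have tabs: "T \<in> tabs" "S \<in> tabs" "cols_increase T" using T S by (auto simp: standard_def)
  obtain U where U: "U \<in> tabs" "col U = col T" "tabloid ls S = tabloid ls U"
    using polytabloid_nonzero[OF tabs(1) nz] by blast
  show ?thesis
  proof (cases "U = T")
    case True
    then show ?thesis using standard_tabloid_unique[OF S T] U(3) by simp
  next
    case False
    then show ?thesis
      using row_weight_less[OF tabs(1,3) U(1,2)] row_weight_tabloid[OF tabs(2) U(1,3)] by simp
  qed
qed

end

section \<open>The quotient and the Specht module\<close>

interpretation fun_space: vector_space "\<lambda>(a::'k::field) (f::'a \<Rightarrow> 'k) x. a * f x"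
  by standard (auto simp: fun_eq_iff algebra_simps)

interpretation fun_space_dual: vector_space_pair
  "\<lambda>(a::'k::field) (f::'a \<Rightarrow> 'k) x. a * f x" "(*) :: 'k \<Rightarrow> 'k \<Rightarrow> 'k"
  by standard (auto simp: algebra_simps)

interpretation fun_space_pair: vector_space_pair
  "\<lambda>(a::'k::field) (f::'a \<Rightarrow> 'k) x. a * f x" "\<lambda>(a::'k) (f::'b \<Rightarrow> 'k) x. a * f x"
  ..

lemma sum_fun_apply: "(\<Sum>i\<in>I. F i) x = (\<Sum>i\<in>I. F i x)" for F :: "'i \<Rightarrow> 'a \<Rightarrow> 'k::comm_monoid_add"
  by (induction I rule: infinite_finite_induct) auto

lemma lin_span_eq_span: "lin_span S = fun_space.span (S :: ('a \<Rightarrow> 'k::field) set)"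
  unfolding lin_span_def fun_space.span_explicit
  by (rule Collect_cong) (auto simp: fun_eq_iff sum_fun_apply)

lemma sum_delta_mult:
  "finite A \<Longrightarrow> x \<in> A \<Longrightarrow> (\<Sum>y\<in>A. delta x y * f y) = (f x :: 'k::comm_ring_1)"
  by (simp add: delta_def if_distrib[of "\<lambda>c. c * f _"] cong: if_cong)

lemma finite_support_eq_sum_delta:
  fixes f :: "'a \<Rightarrow> 'k::comm_ring_1"
  assumes "finite A" "\<And>x. x \<notin> A \<Longrightarrow> f x = 0"
  shows "f = (\<Sum>x\<in>A. (\<lambda>y. f x * delta x y))"
proof
  fix y
  have "(\<Sum>x\<in>A. f x * delta x y) = (\<Sum>x\<in>A. if x = y then f y else 0)"
    by (intro sum.cong) (auto simp: delta_def)
  then show "f y = (\<Sum>x\<in>A. (\<lambda>y. f x * delta x y)) y"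
    using assms by (simp add: sum_fun_apply)
qed

text \<open>The bridge from functionals back to spans. A vector outside the span is independent of a
  basis of it, so some functional is 1 on v and 0 on S.\<close>

lemma in_span_if_annihilated:
  fixes S :: "('a \<Rightarrow> 'k::field) set"
  assumes A: "finite A"
    and S: "\<And>f x. f \<in> S \<Longrightarrow> x \<notin> A \<Longrightarrow> f x = 0"
    and v: "\<And>x. x \<notin> A \<Longrightarrow> v x = 0"
    and ann: "\<And>a. (\<And>f. f \<in> S \<Longrightarrow> (\<Sum>x\<in>A. f x * a x) = 0) \<Longrightarrow> (\<Sum>x\<in>A. v x * a x) = 0"
  shows "v \<in> fun_space.span S"
proof (rule ccontr)
  assume nv: "v \<notin> fun_space.span S"
  obtain B where B: "B \<subseteq> S" "fun_space.independent B" "S \<subseteq> fun_space.span B"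
    using fun_space.maximal_independent_subset by blast
  have "v \<notin> fun_space.span B" using nv B(1) fun_space.span_mono by blast
  then have "fun_space.independent (insert v B)" and vB: "v \<notin> B"
    using B(2) fun_space.independent_insertI fun_space.span_base by blast+
  then obtain g where g: "Vector_Spaces.linear (\<lambda>a f x. a * f x) (*) g"
      "\<And>f. f \<in> insert v B \<Longrightarrow> g f = (if f = v then 1 else 0)"
    using fun_space_dual.linear_independent_extend[of "insert v B" "\<lambda>f. if f = v then 1 else 0"]
    by blast
  interpret g: Vector_Spaces.linear "\<lambda>a f x. a * f x" "(*)" g by (rule g(1))
  \<comment> \<open>Finite support turns g into a weight function on A, the form to which
    \<open>ann\<close> applies.\<close>
  have gsum: "g f = (\<Sum>x\<in>A. f x * g (delta x))" if "\<And>x. x \<notin> A \<Longrightarrow> f x = 0" for f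
  proof -
    have "g f = g (\<Sum>x\<in>A. (\<lambda>y. f x * delta x y))"
      using finite_support_eq_sum_delta[OF A, of f] that by metis
    also have "\<dots> = (\<Sum>x\<in>A. g (\<lambda>y. f x * delta x y))" by (rule g.sum)
    also have "\<dots> = (\<Sum>x\<in>A. f x * g (delta x))"
      by (intro sum.cong refl) (rule g.scale)
    finally show ?thesis .
  qed
  have g0: "g f = 0" if "f \<in> S" for f
  proof (rule fun_space_dual.linear_eq_0_on_span[OF g(1)])
    show "f \<in> fun_space.span B" using that B(3) by blast
    show "g x = 0" if "x \<in> B" for x using g(2)[of x] that vB by auto
  qed
  have "(\<Sum>x\<in>A. v x * g (delta x)) = 0"
    using ann[of "\<lambda>x. g (delta x)"] g0 gsum S by metis
  moreover have "g v = 1" using g(2)[of v] by simp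
  ultimately show False using gsum[of v] v by simp
qed

context partition_shape
begin

lemma tabs_nonempty: "\<exists>T. T \<in> tabs"
proof -
  obtain f where f: "bij_betw f Y {1..r}"
    using finite_same_card_bij[OF finite_diagram, of "{1..r}"] card_diagram by auto
  then have "(\<lambda>x. if x \<in> Y then f x else 0) \<in> tabs"
    by (auto simp: tableaux_def cong: bij_betw_cong)
  then show ?thesis by blast
qed

section \<open>Relations and their annihilators\<close>

definition relations :: "nat list \<Rightarrow> (tableau \<Rightarrow> 'k::comm_ring_1) set" where
  "relations ks = column_relations ls \<union> garnir_relations ls ks"

definition admissible :: "nat list \<Rightarrow> bool" where
  "admissible ks \<longleftrightarrow> (\<forall>c. Suc c < length (conj_part ls) \<longrightarrow> 0 < ks ! c \<and> ks ! c \<le> L (Suc c))"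

lemma garnir_element_eq:
  "Suc c < length (conj_part ls) \<Longrightarrow> garnir_element ls T c k =
    (\<lambda>U. delta T U - (\<Sum>A\<in>{A. A \<subseteq> {0..<L c} \<and> card A = k}. delta (garnir_exchange T c A) U))"
  by (simp add: garnir_element_def conj_part_nth)

lemma garnir_exchange_tab:
  "T \<in> tabs \<Longrightarrow> k \<le> L (Suc c) \<Longrightarrow> A \<in> {A. A \<subseteq> {0..<L c} \<and> card A = k} \<Longrightarrow> garnir_exchange T c A \<in> tabs"
  using garnir_exchange(1)[of T A c] by simp

lemma relations_support:
  assumes "admissible ks" "f \<in> relations ks" "T \<notin> tabs"
  shows "f T = (0 :: 'k::comm_ring_1)"
proof -
  have d: "delta S T = (0 :: 'k)" if "S \<in> tabs" for S
    using that assms(3) by (auto simp: delta_def)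
  consider S p q where "S \<in> tabs" "p \<in> Y" "q \<in> Y" "f = (\<lambda>U. delta S U + delta (S(p := S q, q := S p)) U)"
    | S c where "S \<in> tabs" "Suc c < length (conj_part ls)" "f = garnir_element ls S c (ks ! c)"
    using assms(2) unfolding relations_def column_relations_def garnir_relations_def by blast
  then show ?thesis
  proof cases
    case 1
    have "S(p := S q, q := S p) \<in> tabs"
      unfolding swap_eq_transpose[OF 1(1-3)]
      using 1 tab_image[OF 1(1)] by (intro perm_tab permutes_swap_id) auto
    then show ?thesis using 1 d by simp
  next
    case 2
    then have "ks ! c \<le> L (Suc c)" using assms(1) by (simp add: admissible_def)
    then show ?thesis
      using 2(1) by (simp add: 2(3) garnir_element_eq[OF 2(2)] d garnir_exchange_tab)
  qed
qed

lemma column_relations_annihilator_iff: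
  fixes a :: "tableau \<Rightarrow> 'k::comm_ring_1"
  shows "(\<forall>f\<in>column_relations ls. (\<Sum>T\<in>tabs. f T * a T) = 0) \<longleftrightarrow> column_alternating a"
proof -
  have eq: "(\<Sum>U\<in>tabs. (delta T U + delta (T(p := T q, q := T p)) U) * a U) =
      a T + a (transpose (T p) (T q) \<circ> T)" if T: "T \<in> tabs" "p \<in> Y" "q \<in> Y" for T p q
  proof -
    have "transpose (T p) (T q) \<circ> T \<in> tabs"
      using T tab_image[OF T(1)] by (intro perm_tab permutes_swap_id) auto
    then show ?thesis
      unfolding swap_eq_transpose[OF T]
      by (simp add: distrib_right sum.distrib sum_delta_mult finite_tabs T(1))
  qed
  have rel: "f \<in> column_relations ls \<longleftrightarrow> (\<exists>T\<in>tabs. \<exists>j i i'. i < L j \<and> i' < L j \<and> i \<noteq> i' \<and>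
      f = (\<lambda>U. delta T U + delta (T((i, j) := T (i', j), (i', j) := T (i, j))) U))"
    for f :: "tableau \<Rightarrow> 'k"
    unfolding column_relations_def diagram_iff by blast
  show ?thesis
  proof
    assume l: "\<forall>f\<in>column_relations ls. (\<Sum>T\<in>tabs. f T * a T) = 0"
    show "column_alternating a"
      unfolding column_alternating_def
    proof (intro ballI allI impI)
      fix T j i i' assume T: "T \<in> tabs" and i: "i < L j" "i' < L j" "i \<noteq> i'"
      have "(\<Sum>U\<in>tabs. (delta T U + delta (T((i, j) := T (i', j), (i', j) := T (i, j))) U) * a U) = 0"
        by (rule l[rule_format]) (use T i rel in blast)
      then have "a T + a (transpose (T (i, j)) (T (i', j)) \<circ> T) = 0"
        using eq[OF T, of "(i, j)" "(i', j)"] i by (simp add: diagram_iff)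
      then show "a (transpose (T (i, j)) (T (i', j)) \<circ> T) = - a T"
        by (simp add: eq_neg_iff_add_eq_0 add.commute)
    qed
  next
    assume alt: "column_alternating a"
    show "\<forall>f\<in>column_relations ls. (\<Sum>T\<in>tabs. f T * a T) = 0"
    proof
      fix f :: "tableau \<Rightarrow> 'k" assume "f \<in> column_relations ls"
      then obtain T j i i' where T: "T \<in> tabs" and i: "i < L j" "i' < L j" "i \<noteq> i'"
        and f: "f = (\<lambda>U. delta T U + delta (T((i, j) := T (i', j), (i', j) := T (i, j))) U)"
        unfolding rel by blast
      have "(\<Sum>T\<in>tabs. f T * a T) = a T + a (transpose (T (i, j)) (T (i', j)) \<circ> T)"
        unfolding f by (rule eq) (use T i in \<open>auto simp: diagram_iff\<close>)
      also have "\<dots> = 0" using alt T i by (simp add: column_alternating_def)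
      finally show "(\<Sum>T\<in>tabs. f T * a T) = 0" .
    qed
  qed
qed

lemma garnir_element_pairing:
  fixes a :: "tableau \<Rightarrow> 'k::comm_ring_1"
  assumes T: "T \<in> tabs" and c: "Suc c < length (conj_part ls)" and k: "k \<le> L (Suc c)"
  shows "(\<Sum>U\<in>tabs. garnir_element ls T c k U * a U) = 0 \<longleftrightarrow> garnir_at a T c k"
proof -
  let ?\<A> = "{A. A \<subseteq> {0..<L c} \<and> card A = k}"
  have "(\<Sum>U\<in>tabs. garnir_element ls T c k U * a U) =
      (\<Sum>U\<in>tabs. delta T U * a U) - (\<Sum>U\<in>tabs. \<Sum>A\<in>?\<A>. delta (garnir_exchange T c A) U * a U)"
    unfolding garnir_element_eq[OF c]
    by (simp add: left_diff_distrib sum_subtractf sum_distrib_right)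
  also have "(\<Sum>U\<in>tabs. \<Sum>A\<in>?\<A>. delta (garnir_exchange T c A) U * a U) =
      (\<Sum>A\<in>?\<A>. \<Sum>U\<in>tabs. delta (garnir_exchange T c A) U * a U)"
    by (rule sum.swap)
  also have "\<dots> = (\<Sum>A\<in>?\<A>. a (garnir_exchange T c A))"
    using garnir_exchange_tab[OF T k] by (intro sum.cong refl sum_delta_mult finite_tabs)
  finally show ?thesis
    by (simp add: sum_delta_mult[OF finite_tabs T] garnir_at_def)
qed

text \<open>This describes the dual space of the quotient.\<close>

lemma relations_annihilator_iff:
  fixes a :: "tableau \<Rightarrow> 'k::comm_ring_1"
  assumes "admissible ks"
  shows "(\<forall>f\<in>relations ks. (\<Sum>T\<in>tabs. f T * a T) = 0) \<longleftrightarrow>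
    column_alternating a \<and> (\<forall>T\<in>tabs. \<forall>c. Suc c < length (conj_part ls) \<longrightarrow> garnir_at a T c (ks ! c))"
proof -
  have "(\<forall>f\<in>garnir_relations ls ks. (\<Sum>T\<in>tabs. f T * a T) = 0) \<longleftrightarrow>
    (\<forall>T\<in>tabs. \<forall>c. Suc c < length (conj_part ls) \<longrightarrow>
       (\<Sum>U\<in>tabs. garnir_element ls T c (ks ! c) U * a U) = 0)"
    unfolding garnir_relations_def by blast
  also have "\<dots> \<longleftrightarrow> (\<forall>T\<in>tabs. \<forall>c. Suc c < length (conj_part ls) \<longrightarrow> garnir_at a T c (ks ! c))"
    using garnir_element_pairing[of _ _ "ks ! _" a] assms by (auto simp: admissible_def)
  finally show ?thesis
    unfolding relations_def ball_Un column_relations_annihilator_iff by blast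
qed

section \<open>The map from tableaux to polytabloids\<close>

definition to_specht :: "(tableau \<Rightarrow> 'k::comm_ring_1) \<Rightarrow> (nat \<times> nat) set \<Rightarrow> 'k" where
  "to_specht f = (\<lambda>\<tau>. \<Sum>T\<in>tabs. f T * polytabloid ls T \<tau>)"

lemma linear_to_specht:
  "Vector_Spaces.linear (\<lambda>(a::'k::field) f x. a * f x) (\<lambda>a f x. a * f x) to_specht"
  unfolding Vector_Spaces.linear_iff
proof (intro conjI allI)
  fix f g :: "tableau \<Rightarrow> 'k" and c :: 'k
  show "to_specht (f + g) = to_specht f + to_specht g"
    by (rule ext) (simp add: to_specht_def distrib_right sum.distrib)
  show "to_specht (\<lambda>x. c * f x) = (\<lambda>x. c * to_specht f x)"
    by (simp only: to_specht_def sum_distrib_left mult.assoc)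
qed (rule fun_space.vector_space_axioms)+

lemma to_specht_delta: "T \<in> tabs \<Longrightarrow> to_specht (delta T) = (polytabloid ls T :: _ \<Rightarrow> 'k::comm_ring_1)"
  unfolding to_specht_def by (rule ext) (rule sum_delta_mult[OF finite_tabs])

text \<open>For each tabloid, its coefficient in the polytabloid of T is, as a function of T, a
  functional that annihilates all relations.\<close>

lemma to_specht_relations:
  fixes f :: "tableau \<Rightarrow> 'k::field_char_0"
  assumes admissible: "admissible ks" and f: "f \<in> fun_space.span (relations ks)"
  shows "to_specht f = 0"
proof (rule fun_space_pair.linear_eq_0_on_span[OF linear_to_specht _ f])
  fix g :: "tableau \<Rightarrow> 'k" assume g: "g \<in> relations ks"
  show "to_specht g = 0"
  proof
    fix \<tau>
    have "\<forall>f\<in>relations ks. (\<Sum>T\<in>tabs. f T * (polytabloid ls T \<tau> :: 'k)) = 0"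
      unfolding relations_annihilator_iff[OF admissible]
    proof (intro conjI ballI allI impI)
      fix T c assume "T \<in> tabs" "Suc c < length (conj_part ls)"
      then show "garnir_at (\<lambda>T. polytabloid ls T \<tau> :: 'k) T c (ks ! c)"
        using admissible by (intro garnir_at_polytabloid) (auto simp: admissible_def)
    qed (rule column_alternating_polytabloid)
    then show "to_specht g \<tau> = 0 \<tau>" using g by (simp add: to_specht_def)
  qed
qed

lemma finite_standard: "finite standard"
  using finite_tabs by (simp add: standard_def)

lemma standard_tab: "T \<in> standard \<Longrightarrow> T \<in> tabs"
  by (simp add: standard_def)

lemma span_standard_support:
  fixes f :: "tableau \<Rightarrow> 'k::field"
  assumes "f \<in> fun_space.span (delta ` standard)" "T \<notin> standard"
  shows "f T = 0"
  using assms(1)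
proof (induction rule: fun_space.span_induct_alt)
  case (step c g h)
  then obtain S where "S \<in> standard" "g = delta S" by blast
  then have "S \<noteq> T" "g T = (if T = S then 1 else 0)" using assms(2) by (auto simp: delta_def)
  then show ?case using step(2) by simp
qed simp

text \<open>Take S of maximal row weight in the support of f. By triangularity only S itself
  contributes to the coefficient at the tabloid of S, which is therefore f S.\<close>

lemma to_specht_standard_inj:
  fixes f :: "tableau \<Rightarrow> 'k::field"
  assumes f: "f \<in> fun_space.span (delta ` standard)" and 0: "to_specht f = 0"
  shows "f = 0"
proof (rule ccontr)
  assume "f \<noteq> 0"
  define N where "N = {T. f T \<noteq> 0}"
  have supp: "N \<subseteq> standard" using span_standard_support[OF f] by (auto simp: N_def)
  have "finite N" "N \<noteq> {}"
    using supp finite_standard finite_subset \<open>f \<noteq> 0\<close> by (auto simp: N_def fun_eq_iff)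
  then obtain S where S: "S \<in> N" "\<And>T. T \<in> N \<Longrightarrow> row_weight T \<le> row_weight S"
    using finite_attains_max[of N row_weight] by blast
  have stdS: "S \<in> standard" using S supp by blast
  then have tS: "S \<in> tabs" "cols_increase S" by (auto simp: standard_def)
  have "(\<Sum>T\<in>tabs. f T * polytabloid ls T (tabloid ls S)) =
      (\<Sum>T\<in>{S}. f T * polytabloid ls T (tabloid ls S))"
  proof (rule sum.mono_neutral_right)
    show "\<forall>T\<in>tabs - {S}. f T * polytabloid ls T (tabloid ls S) = 0"
    proof
      fix T assume T: "T \<in> tabs - {S}"
      show "f T * polytabloid ls T (tabloid ls S) = 0"
      proof (rule ccontr)
        assume nz: "f T * polytabloid ls T (tabloid ls S) \<noteq> 0"
        then have TN: "T \<in> N" by (auto simp: N_def)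
        then have "S = T \<or> row_weight S < row_weight T"
          using polytabloid_triangular[OF _ stdS, of T, where 'k = 'k] supp nz by auto
        then show False using T S(2)[OF TN] by auto
      qed
    qed
  qed (use finite_tabs tS in auto)
  also have "\<dots> = f S" using polytabloid_self[OF tS, where 'k = 'k] by simp
  finally have "to_specht f (tabloid ls S) = f S" by (simp add: to_specht_def)
  then show False using 0 S(1) by (simp add: N_def)
qed

text \<open>As \<open>ks ! c\<close> is at most \<open>L (Suc c)\<close>, which is at most
  \<open>L c\<close>, the disjunction excludes only \<open>ks ! c = L (Suc c) = L c > 1\<close>.
  This covers the positive cases of both parts.\<close>

definition presenting :: "nat list \<Rightarrow> bool" where
  "presenting ks \<longleftrightarrow> (\<forall>c. Suc c < length (conj_part ls) \<longrightarrow>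
     0 < ks ! c \<and> ks ! c \<le> L (Suc c) \<and> (ks ! c < L c \<or> ks ! c = 1))"

lemma presenting_imp_admissible: "presenting ks \<Longrightarrow> admissible ks"
  by (simp add: presenting_def admissible_def)

text \<open>Straightening by duality: a functional that kills the relations and vanishes on the
  standard tableaux is zero on all tableaux.\<close>

lemma span_relations_standard:
  fixes f :: "tableau \<Rightarrow> 'k::field_char_0"
  assumes ks: "presenting ks" and f: "f \<in> free_space ls"
  shows "f \<in> fun_space.span (relations ks \<union> delta ` standard)"
proof (rule in_span_if_annihilated[OF finite_tabs])
  show "f T = 0" if "T \<notin> tabs" for T using f that by (simp add: free_space_def)
  show "g T = 0" if "g \<in> relations ks \<union> delta ` standard" "T \<notin> tabs" for g T
    using that relations_support[OF presenting_imp_admissible[OF ks]] standard_tab by (auto simp: delta_def)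
  fix a :: "tableau \<Rightarrow> 'k"
  assume ann: "\<And>g. g \<in> relations ks \<union> delta ` standard \<Longrightarrow> (\<Sum>T\<in>tabs. g T * a T) = 0"
  then have "\<forall>g\<in>relations ks. (\<Sum>T\<in>tabs. g T * a T) = 0" by blast
  then have alt: "column_alternating a"
    and gar: "\<And>T c. T \<in> tabs \<Longrightarrow> Suc c < length (conj_part ls) \<Longrightarrow> garnir_at a T c (ks ! c)"
    unfolding relations_annihilator_iff[OF presenting_imp_admissible[OF ks]] by blast+
  have std: "a T = 0" if "T \<in> standard" for T
    using ann[of "delta T"] that sum_delta_mult[OF finite_tabs standard_tab, of T a] by simp
  have "a T = 0" if T: "T \<in> tabs" for T
  proof (rule zero_if_zero_on_standard[OF alt _ std T])
    fix T c k assume T: "T \<in> tabs" and k: "0 < k" "k \<le> L (Suc c)"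
    then have c: "Suc c < length (conj_part ls)" by (simp add: less_length_conj_part)
    then have "0 < ks ! c" "ks ! c \<le> L (Suc c)" "ks ! c < L c \<or> ks ! c = 1"
      using ks by (auto simp: presenting_def)
    then show "garnir_at a T c k"
      using garnir_at_all[OF alt T _ _ _ gar k] c by blast
  qed
  then show "(\<Sum>T\<in>tabs. f T * a T) = 0" by simp
qed

lemma free_space_decompose:
  fixes f :: "tableau \<Rightarrow> 'k::field_char_0"
  assumes "presenting ks" "f \<in> free_space ls"
  obtains w s where "w \<in> fun_space.span (relations ks)" "s \<in> fun_space.span (delta ` standard)" "f = w + s"
  using span_relations_standard[OF assms] unfolding fun_space.span_Un by blast

lemma subspace_free_space: "fun_space.subspace (free_space ls :: (tableau \<Rightarrow> 'k::field) set)"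
  by (rule fun_space.subspaceI) (auto simp: free_space_def)

lemma span_relations_free:
  assumes "admissible ks"
  shows "fun_space.span (relations ks) \<subseteq> (free_space ls :: (tableau \<Rightarrow> 'k::field) set)"
  using relations_support[OF assms] subspace_free_space
  by (intro fun_space.span_minimal) (auto simp: free_space_def)

text \<open>Modulo relations only a combination of standard tableaux remains, and there
  \<open>to_specht\<close> is injective.\<close>

lemma to_specht_kernel:
  assumes ks: "presenting ks"
  shows "{f \<in> free_space ls. to_specht f = 0} = (fun_space.span (relations ks) :: (tableau \<Rightarrow> 'k::field_char_0) set)"
proof (intro equalityI subsetI)
  fix f :: "tableau \<Rightarrow> 'k" assume f: "f \<in> {f \<in> free_space ls. to_specht f = 0}"
  then obtain w s where ws: "w \<in> fun_space.span (relations ks)" "s \<in> fun_space.span (delta ` standard)" "f = w + s"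
    using free_space_decompose[OF ks] by blast
  have "to_specht f = to_specht w + to_specht s"
    unfolding ws(3) by (rule fun_space_pair.linear_add[OF linear_to_specht])
  then have "to_specht s = 0"
    using f to_specht_relations[OF presenting_imp_admissible[OF ks] ws(1)] by simp
  then have "s = 0" by (rule to_specht_standard_inj[OF ws(2)])
  then show "f \<in> fun_space.span (relations ks)" using ws by simp
next
  fix f :: "tableau \<Rightarrow> 'k" assume "f \<in> fun_space.span (relations ks)"
  then show "f \<in> {f \<in> free_space ls. to_specht f = 0}"
    using to_specht_relations[OF presenting_imp_admissible[OF ks]] span_relations_free[OF presenting_imp_admissible[OF ks]] by blast
qed

lemma specht_module_eq:
  "specht_module ls = (fun_space.span (polytabloid ls ` tabs) :: ((nat \<times> nat) set \<Rightarrow> 'k::field) set)"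
  unfolding specht_module_def lin_span_eq_span by (rule arg_cong[of _ _ fun_space.span]) auto

lemma free_space_eq: "free_space ls = (fun_space.span (delta ` tabs) :: (tableau \<Rightarrow> 'k::field) set)"
proof (intro equalityI subsetI)
  fix f :: "tableau \<Rightarrow> 'k" assume "f \<in> free_space ls"
  then have "f = (\<Sum>T\<in>tabs. (\<lambda>U. f T * delta T U))"
    by (intro finite_support_eq_sum_delta finite_tabs) (simp add: free_space_def)
  moreover have "(\<Sum>T\<in>tabs. (\<lambda>U. f T * delta T U)) \<in> fun_space.span (delta ` tabs)"
    by (intro fun_space.span_sum fun_space.span_scale fun_space.span_base) auto
  ultimately show "f \<in> fun_space.span (delta ` tabs)" by simp
next
  fix f :: "tableau \<Rightarrow> 'k" assume "f \<in> fun_space.span (delta ` tabs)"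
  moreover have "fun_space.span (delta ` tabs) \<subseteq> (free_space ls :: (tableau \<Rightarrow> 'k) set)"
    by (rule fun_space.span_minimal[OF _ subspace_free_space]) (auto simp: free_space_def delta_def)
  ultimately show "f \<in> free_space ls" by blast
qed

lemma to_specht_image: "to_specht ` free_space ls = (specht_module ls :: ((nat \<times> nat) set \<Rightarrow> 'k::field) set)"
proof -
  have "to_specht ` free_space ls = (fun_space.span (to_specht ` delta ` tabs) :: ((nat \<times> nat) set \<Rightarrow> 'k) set)"
    unfolding free_space_eq by (rule fun_space_pair.linear_span_image[OF linear_to_specht, symmetric])
  also have "to_specht ` delta ` tabs = (polytabloid ls ` tabs :: ((nat \<times> nat) set \<Rightarrow> 'k) set)"
    by (simp add: image_image to_specht_delta)
  finally show ?thesis by (simp add: specht_module_eq)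
qed

lemma to_specht_equivariant:
  fixes f :: "tableau \<Rightarrow> 'k::comm_ring_1"
  assumes \<sigma>: "\<sigma> permutes {1..r}"
  shows "to_specht (act_tab \<sigma> f) = act_tabloid \<sigma> (to_specht f)"
proof
  fix \<tau>
  note si = permutes_inverses[OF \<sigma>]
  have "(\<Sum>T\<in>tabs. f (inv \<sigma> \<circ> T) * polytabloid ls T \<tau>) =
      (\<Sum>T\<in>tabs. f T * polytabloid ls T (map_prod (inv \<sigma>) id ` \<tau>))"
  proof (rule sum.reindex_bij_witness[where j = "\<lambda>T. inv \<sigma> \<circ> T" and i = "\<lambda>T. \<sigma> \<circ> T"])
    fix T assume T: "T \<in> tabs"
    show eq: "\<sigma> \<circ> (inv \<sigma> \<circ> T) = T" "inv \<sigma> \<circ> (\<sigma> \<circ> T) = T" by (simp_all add: fun_eq_iff si)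
    show "\<sigma> \<circ> T \<in> tabs" by (rule perm_tab[OF T \<sigma>])
    show tab: "inv \<sigma> \<circ> T \<in> tabs" by (rule perm_tab[OF T permutes_inv[OF \<sigma>]])
    show "f (inv \<sigma> \<circ> T) * polytabloid ls (inv \<sigma> \<circ> T) (map_prod (inv \<sigma>) id ` \<tau>) =
        f (inv \<sigma> \<circ> T) * polytabloid ls T \<tau>"
      using polytabloid_perm[OF tab \<sigma>, of \<tau>, where 'k = 'k] by (simp only: eq)
  qed
  then show "to_specht (act_tab \<sigma> f) \<tau> = act_tabloid \<sigma> (to_specht f) \<tau>"
    by (simp add: to_specht_def act_tab_def act_tabloid_def)
qed

theorem presenting_imp_iso:
  assumes "presenting ks"
  shows "garnir_quotient_iso_specht TYPE('k::field_char_0) ls ks"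
  unfolding garnir_quotient_iso_specht_def lin_span_eq_span relations_def[symmetric]
proof (intro exI[of _ "to_specht :: (tableau \<Rightarrow> 'k) \<Rightarrow> _"] conjI ballI allI impI)
  fix f g :: "tableau \<Rightarrow> 'k" and a :: 'k
  show "to_specht (\<lambda>T. f T + g T) = (\<lambda>\<tau>. to_specht f \<tau> + to_specht g \<tau>)"
    by (simp add: to_specht_def distrib_right sum.distrib)
  show "to_specht (\<lambda>T. a * f T) = (\<lambda>\<tau>. a * to_specht f \<tau>)"
    by (simp only: to_specht_def sum_distrib_left mult.assoc)
  show "to_specht ` free_space ls = (specht_module ls :: (_ \<Rightarrow> 'k) set)"
    by (rule to_specht_image)
  show "{f \<in> free_space ls. to_specht f = (\<lambda>_. 0 :: 'k)} = fun_space.span (relations ks)"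
    using to_specht_kernel[OF assms] by (simp add: zero_fun_def)
  show "to_specht (act_tab \<sigma> f) = act_tabloid \<sigma> (to_specht f)" if "\<sigma> permutes {1..r}" for \<sigma>
    by (rule to_specht_equivariant[OF that])
qed

end

section \<open>Exchanging two columns of equal length\<close>

context partition_shape
begin

text \<open>After twisting, the exchange of whole columns says that h takes equal values, up to
  (-1)^n, on a set and its complement. The indicator function of B, symmetrised accordingly, is the
  simplest solution.\<close>

definition swap_functional :: "nat set \<Rightarrow> tableau \<Rightarrow> 'k::comm_ring_1" where
  "swap_functional B T = of_int (tab_sign T) *
     (of_bool (col T 1 = B) + (-1) ^ L 1 * of_bool (col T 0 = B))"

lemma column_alternating_swap_functional: "column_alternating (swap_functional B)"
  unfolding column_alternating_def
proof (intro ballI allI impI)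
  fix T j i i' assume T: "T \<in> tabs" and i: "i < L j" "i' < L j" "i \<noteq> i'"
  let ?g = "transpose (T (i, j)) (T (i', j))"
  have "T (i, j) \<noteq> T (i', j)" using T i by (simp add: tab_eq_iff)
  moreover have g: "?g \<in> col_stab ls T"
    by (rule transpose_col_stab[OF T col_memI[OF i(1)] col_memI[OF i(2)]])
  then have "col (?g \<circ> T) = col T" by (simp add: fun_eq_iff col_perm col_stab_iff[OF T])
  ultimately show "swap_functional B (?g \<circ> T) = - (swap_functional B T :: 'a)"
    by (simp add: swap_functional_def tab_sign_perm[OF T col_stab_permutes[OF g]] sign_swap_id)
qed

text \<open>When k is the length of both columns, the only summand exchanges them entirely.\<close>

lemma garnir_at_swap_functional:
  assumes eq: "L 0 = L 1" and T: "T \<in> tabs"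
  shows "garnir_at (swap_functional B :: _ \<Rightarrow> 'k::comm_ring_1) T 0 (L 1)"
proof -
  let ?A = "{0..<L 0}"
  have "{A. A \<subseteq> {0..<L 0} \<and> card A = L 1} = {?A}"
    using eq card_subset_eq[of "{0..<L 0}"] by auto
  moreover have "swap_functional B (garnir_exchange T 0 ?A) = (swap_functional B T :: 'k)"
  proof -
    have A: "?A \<subseteq> {0..<L 0}" "card ?A \<le> L (Suc 0)" using eq by simp_all
    note ge = garnir_exchange[OF T A]
    have "(\<lambda>i. T (i, Suc 0)) ` {..<card ?A} = col T 1" "(\<lambda>i. T (i, 0)) ` ?A = col T 0"
      using eq by (simp_all add: column_def atLeast0LessThan)
    then have "col (garnir_exchange T 0 ?A) 0 = col T 1" "col (garnir_exchange T 0 ?A) 1 = col T 0"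
      unfolding ge(3) by simp_all
    moreover have "(-1) ^ L 1 * (-1) ^ L 1 = (1 :: 'k)" by (simp flip: power_add)
    ultimately show ?thesis
      using eq unfolding swap_functional_def ge(2) by (simp add: algebra_simps)
  qed
  ultimately show ?thesis by (simp add: garnir_at_def)
qed

text \<open>Exchanging one entry yields neither B nor its complement as right column once the
  columns have two entries, so the sum is 0 while the value at T is a sign.\<close>

lemma not_garnir_at_swap_functional:
  assumes "2 \<le> L 0" "0 < L 1" and T: "T \<in> tabs"
  shows "\<not> garnir_at (swap_functional (col T 1) :: _ \<Rightarrow> 'k::field_char_0) T 0 1"
proof
  let ?a = "swap_functional (col T 1) :: _ \<Rightarrow> 'k"
  have disj: "col T 0 \<inter> col T 1 = {}" using col_disjoint[OF T] by simp
  have ne: "col T 0 \<noteq> {}" "col T 1 \<noteq> {}" "2 \<le> card (col T 0)"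
    using assms card_col[OF T, of 0] card_col[OF T, of 1] by auto
  assume "garnir_at ?a T 0 1"
  then have "?a T = (\<Sum>A\<in>{A. A \<subseteq> {0..<L 0} \<and> card A = 1}. ?a (garnir_exchange T 0 A))"
    by (simp add: garnir_at_def)
  also have "\<dots> = 0"
  proof (rule sum.neutral, rule ballI)
    fix A assume "A \<in> {A. A \<subseteq> {0..<L 0} \<and> card A = 1}"
    then have A: "A \<subseteq> {0..<L 0}" "card A = 1" by auto
    then have "card A \<le> L (Suc 0)" using assms(2) by simp
    note ge = garnir_exchange[OF T A(1) this, unfolded A(2)]
    obtain q where q: "A = {q}" using A(2) card_1_singletonE by blast
    define x where "x = T (0, Suc 0)"
    define y where "y = T (q, 0)"
    have x: "x \<in> col T 1" unfolding x_def using assms(2) col_memI[of 0 1 T] by simp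
    have y: "y \<in> col T 0" unfolding y_def using A(1) q col_memI[of q 0 T] by simp
    have "(\<lambda>i. T (i, Suc 0)) ` {..<1} = {x}" "(\<lambda>i. T (i, 0)) ` A = {y}"
      by (auto simp: x_def y_def q lessThan_Suc)
    then have cols: "col (garnir_exchange T 0 A) 0 = col T 0 - {y} \<union> {x}"
        "col (garnir_exchange T 0 A) 1 = col T 1 - {x} \<union> {y}"
      unfolding ge(3) by simp_all
    have "col (garnir_exchange T 0 A) 1 \<noteq> col T 1"
      unfolding cols using x y disj by blast
    moreover have "col (garnir_exchange T 0 A) 0 \<noteq> col T 1"
    proof
      assume "col (garnir_exchange T 0 A) 0 = col T 1"
      then have "col T 0 \<subseteq> {y}" unfolding cols using disj by blast
      then have "card (col T 0) \<le> card {y}" by (intro card_mono) auto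
      then show False using ne(3) by simp
    qed
    ultimately show "?a (garnir_exchange T 0 A) = 0" by (simp add: swap_functional_def)
  qed
  finally have "?a T = 0" .
  moreover have "?a T = of_int (tab_sign T)"
    using disj ne by (auto simp: swap_functional_def)
  ultimately have "tab_sign T = 0" by simp
  then show False using tab_sign_square[of T] by simp
qed

section \<open>Comparison of dimensions\<close>

lemma independent_standard:
  "fun_space.independent (delta ` standard :: (tableau \<Rightarrow> 'k::field) set)"
proof (rule fun_space.independent_if_scalars_zero)
  show "finite (delta ` standard :: (tableau \<Rightarrow> 'k) set)" using finite_standard by simp
  fix f :: "(tableau \<Rightarrow> 'k) \<Rightarrow> 'k" and x :: "tableau \<Rightarrow> 'k"
  assume 0: "(\<Sum>x\<in>delta ` standard. (\<lambda>T. f x * x T)) = 0" and "x \<in> delta ` standard"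
  then obtain S where S: "S \<in> standard" "x = delta S" by blast
  have inj: "inj_on (delta :: tableau \<Rightarrow> tableau \<Rightarrow> 'k) standard"
  proof (rule inj_onI)
    fix T U assume "delta T = (delta U :: tableau \<Rightarrow> 'k)"
    then have "delta T T = (delta U T :: 'k)" by simp
    then show "T = U" by (simp add: delta_def split: if_splits)
  qed
  have "0 = (\<Sum>x\<in>delta ` standard. (\<lambda>T. f x * x T)) S" unfolding 0 by simp
  also have "\<dots> = (\<Sum>T\<in>standard. f (delta T) * delta T S)"
    unfolding sum_fun_apply by (subst sum.reindex[OF inj]) (simp add: comp_def)
  also have "\<dots> = (\<Sum>T\<in>standard. if T = S then f (delta S) else 0)"
    by (intro sum.cong) (auto simp: delta_def)
  also have "\<dots> = f x" using S finite_standard by simp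
  finally show "f x = 0" by simp
qed

text \<open>An isomorphism is constrained only on \<open>free_space ls\<close>. Composing it with
  the restriction R to tableaux gives a map that is linear on all functions and agrees with it
  there.\<close>

lemma iso_imp_linear:
  assumes "garnir_quotient_iso_specht TYPE('k::field) ls ks"
  obtains \<phi> :: "(tableau \<Rightarrow> 'k::field) \<Rightarrow> ((nat \<times> nat) set \<Rightarrow> 'k)"
  where "Vector_Spaces.linear (\<lambda>a f x. a * f x) (\<lambda>a f x. a * f x) \<phi>"
    and "\<And>f. f \<in> free_space ls \<Longrightarrow> \<phi> f \<in> specht_module ls"
    and "\<And>f. f \<in> free_space ls \<Longrightarrow> \<phi> f = 0 \<Longrightarrow> f \<in> fun_space.span (relations ks)"
proof -
  obtain \<psi> :: "(tableau \<Rightarrow> 'k) \<Rightarrow> ((nat \<times> nat) set \<Rightarrow> 'k)" where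
    add: "\<forall>f\<in>free_space ls. \<forall>g\<in>free_space ls. \<psi> (\<lambda>T. f T + g T) = (\<lambda>\<tau>. \<psi> f \<tau> + \<psi> g \<tau>)"
    and scale: "\<forall>a. \<forall>f\<in>free_space ls. \<psi> (\<lambda>T. a * f T) = (\<lambda>\<tau>. a * \<psi> f \<tau>)"
    and im: "\<psi> ` free_space ls = specht_module ls"
    and ker: "{f \<in> free_space ls. \<psi> f = (\<lambda>_. 0)} = fun_space.span (relations ks)"
    using assms unfolding garnir_quotient_iso_specht_def lin_span_eq_span relations_def[symmetric]
    by blast
  define R :: "(tableau \<Rightarrow> 'k) \<Rightarrow> tableau \<Rightarrow> 'k" where "R f T = (if T \<in> tabs then f T else 0)" for f T
  have R: "R f \<in> free_space ls" for f by (simp add: free_space_def R_def)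
  have R_id: "R f = f" if "f \<in> free_space ls" for f
    using that by (auto simp: free_space_def R_def fun_eq_iff)
  have "Vector_Spaces.linear (\<lambda>a f x. a * f x) (\<lambda>a f x. a * f x) (\<psi> \<circ> R)"
    unfolding Vector_Spaces.linear_iff
  proof (intro conjI allI)
    fix f g :: "tableau \<Rightarrow> 'k" and c :: 'k
    have "R (f + g) = (\<lambda>T. R f T + R g T)" "R (\<lambda>x. c * f x) = (\<lambda>T. c * R f T)"
      by (auto simp: R_def)
    then show "(\<psi> \<circ> R) (f + g) = (\<psi> \<circ> R) f + (\<psi> \<circ> R) g"
      "(\<psi> \<circ> R) (\<lambda>x. c * f x) = (\<lambda>x. c * (\<psi> \<circ> R) f x)"
      using add R scale by (simp_all add: plus_fun_def)
  qed (rule fun_space.vector_space_axioms)+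
  then show thesis
  proof (rule that)
    fix f :: "tableau \<Rightarrow> 'k" assume f: "f \<in> free_space ls"
    then show "(\<psi> \<circ> R) f \<in> specht_module ls" using im by (auto simp: R_id)
    assume "(\<psi> \<circ> R) f = 0"
    then have "f \<in> {f \<in> free_space ls. \<psi> f = (\<lambda>_. 0)}" using f by (simp add: R_id zero_fun_def)
    then show "f \<in> fun_space.span (relations ks)" unfolding ker .
  qed
qed

text \<open>Exchanging whole columns leaves a quotient that is too large: otherwise the quotient map would
  send the standard tableaux together with a relation \<open>w\<close> that does not follow from the exchange of
  whole columns to linearly independent vectors of the Specht module, which is spanned by the
  images of the standard tableaux alone.\<close>
lemma not_iso:
  assumes len: "length (conj_part ls) = 2" and eq: "L 0 = L 1" and n: "2 \<le> L 1"
  shows "\<not> garnir_quotient_iso_specht TYPE('k::field_char_0) ls [L 1]"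
proof
  assume "garnir_quotient_iso_specht TYPE('k) ls [L 1]"
  then obtain \<phi> :: "(tableau \<Rightarrow> 'k) \<Rightarrow> ((nat \<times> nat) set \<Rightarrow> 'k)" where
    lin: "Vector_Spaces.linear (\<lambda>a f x. a * f x) (\<lambda>a f x. a * f x) \<phi>"
    and im: "\<And>f. f \<in> free_space ls \<Longrightarrow> \<phi> f \<in> specht_module ls"
    and ker: "\<And>f. f \<in> free_space ls \<Longrightarrow> \<phi> f = 0 \<Longrightarrow> f \<in> fun_space.span (relations [L 1])"
    by (rule iso_imp_linear) blast
  obtain T where T: "T \<in> tabs" using tabs_nonempty by blast
  have c0: "Suc c < length (conj_part ls) \<longleftrightarrow> c = 0" for c using len by auto
  \<comment> \<open>The parameter 1 always presents the Specht module, so it serves as the reference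
    against which the relations for \<open>L 1\<close> fall short.\<close>
  have pres: "presenting [1]" and adm_n: "admissible [L 1]"
    using n by (auto simp: presenting_def admissible_def c0)
  define a :: "tableau \<Rightarrow> 'k" where "a = swap_functional (col T 1)"
  have ann_n: "(\<Sum>T\<in>tabs. f T * a T) = 0" if "f \<in> relations [L 1]" for f
    using that relations_annihilator_iff[OF adm_n, of a] garnir_at_swap_functional[OF eq]
      column_alternating_swap_functional by (auto simp: a_def c0)
  define p where "p f = (\<Sum>T\<in>tabs. f T * a T)" for f
  have "\<not> garnir_at a T 0 1"
    unfolding a_def using eq n by (intro not_garnir_at_swap_functional T) auto
  \<comment> \<open>Some relation for the parameter 1 is detected by a functional that kills all
    relations for \<open>L 1\<close>.\<close>
  then obtain w where w: "w \<in> relations [1]" "p w \<noteq> 0"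
    using relations_annihilator_iff[OF presenting_imp_admissible[OF pres], of a] T by (auto simp: c0 p_def)
  have p_add: "p (f + g) = p f + p g" for f g
    by (simp add: p_def distrib_right sum.distrib)
  have p_scale: "p (\<lambda>x. c * f x) = c * p f" for c f
    by (simp only: p_def sum_distrib_left mult.assoc)
  have p_n: "p f = 0" if "f \<in> fun_space.span (relations [L 1])" for f
    using that
  proof (induction rule: fun_space.span_induct_alt)
    case base
    show ?case by (simp add: p_def)
  next
    case (step c g h)
    then show ?case unfolding p_add p_scale using ann_n[of g] by (simp add: p_def)
  qed
  have lin': "Vector_Spaces.linear (\<lambda>a f x. a * f x) (\<lambda>a f x. a * f x) (to_specht :: (tableau \<Rightarrow> 'k) \<Rightarrow> _)"
    by (rule linear_to_specht)
  have w0: "to_specht w = 0"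
    using to_specht_relations[OF presenting_imp_admissible[OF pres] fun_space.span_base[OF w(1)]] .
  have w_free: "w \<in> free_space ls"
    using span_relations_free[OF presenting_imp_admissible[OF pres]] fun_space.span_base[OF w(1)] by blast
  let ?D = "delta ` standard :: (tableau \<Rightarrow> 'k) set"
  have D_free: "fun_space.span ?D \<subseteq> free_space ls"
    unfolding free_space_eq by (rule fun_space.span_mono) (auto simp: standard_tab)
  have w_span: "w \<notin> fun_space.span ?D"
  proof
    assume "w \<in> fun_space.span ?D"
    then have "w = 0" using to_specht_standard_inj w0 by blast
    then show False using w(2) by (simp add: p_def)
  qed
  have indep: "fun_space.independent (insert w ?D)"
    by (rule fun_space.independent_insertI[OF w_span independent_standard])
  have inj: "inj_on \<phi> (fun_space.span (insert w ?D))"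
    unfolding fun_space_pair.linear_inj_on_iff_eq_0[OF lin fun_space.subspace_span]
  proof (intro ballI impI)
    fix f assume f: "f \<in> fun_space.span (insert w ?D)" and f0: "\<phi> f = 0"
    obtain c where c: "f - (\<lambda>x. c * w x) \<in> fun_space.span ?D"
      using f unfolding fun_space.span_insert by blast
    define s where "s = f - (\<lambda>x. c * w x)"
    have f_eq: "f = s + (\<lambda>x. c * w x)" by (simp add: s_def)
    have "insert w ?D \<subseteq> free_space ls"
      using w_free D_free fun_space.span_superset[of ?D] by blast
    then have f_free: "f \<in> free_space ls"
      using f fun_space.span_minimal[OF _ subspace_free_space] by blast
    have fn: "f \<in> fun_space.span (relations [L 1])" by (rule ker[OF f_free f0])
    have "to_specht f = to_specht s + (\<lambda>x. c * to_specht w x)"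
      unfolding f_eq fun_space_pair.linear_add[OF lin'] fun_space_pair.linear_scale[OF lin'] ..
    then have "to_specht s = 0"
      using to_specht_relations[OF adm_n fn] w0 by (simp add: zero_fun_def plus_fun_def)
    then have "s = 0" using to_specht_standard_inj c unfolding s_def by blast
    \<comment> \<open>Since f lies in the span of the relations for \<open>L 1\<close>, p kills it,
      whereas p w is nonzero.\<close>
    then have "p f = c * p w" using p_scale[of c w] by (simp add: f_eq)
    then have "c = 0" using p_n[OF fn] w(2) by simp
    then show "f = 0" using \<open>s = 0\<close> by (simp add: f_eq fun_eq_iff)
  qed
  have ind_im: "fun_space.independent (\<phi> ` insert w ?D)"
    by (rule fun_space_pair.linear_independent_injective_image[OF lin indep inj])
  \<comment> \<open>The Specht module is the same for all parameters, so straightening with the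
    parameter 1 bounds its dimension.\<close>
  have "specht_module ls \<subseteq> fun_space.span (to_specht ` ?D)"
  proof
    fix g :: "(nat \<times> nat) set \<Rightarrow> 'k" assume "g \<in> specht_module ls"
    then obtain f where f: "f \<in> free_space ls" "g = to_specht f"
      unfolding to_specht_image[symmetric] by blast
    then obtain u s where us: "u \<in> fun_space.span (relations [1])" "s \<in> fun_space.span ?D" "f = u + s"
      using free_space_decompose[OF pres] by blast
    have "g = to_specht s"
      unfolding f(2) us(3) fun_space_pair.linear_add[OF lin']
      using to_specht_relations[OF presenting_imp_admissible[OF pres] us(1)] by simp
    then show "g \<in> fun_space.span (to_specht ` ?D)"
      using us(2) unfolding fun_space_pair.linear_span_image[OF lin'] by blast
  qed
  moreover have "\<phi> ` insert w ?D \<subseteq> specht_module ls"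
    using im w_free D_free fun_space.span_superset[of ?D] by blast
  ultimately have sub: "\<phi> ` insert w ?D \<subseteq> fun_space.span (to_specht ` ?D)" by blast
  have fin: "finite ?D" using finite_standard by simp
  have "card (\<phi> ` insert w ?D) \<le> card (to_specht ` ?D)"
    using fun_space.independent_span_bound[OF _ ind_im sub] fin by blast
  also have "\<dots> \<le> card ?D" by (rule card_image_le[OF fin])
  finally have "card (\<phi> ` insert w ?D) \<le> card ?D" .
  moreover have "card (\<phi> ` insert w ?D) = card (insert w ?D)"
    by (rule card_image) (rule inj_on_subset[OF inj fun_space.span_superset])
  moreover have "w \<notin> ?D" using w_span fun_space.span_base by blast
  ultimately show False using fin by simp
qed

end

theorem theorem6p4:
  fixes lam :: "nat list" and r :: nat
  assumes "is_partition lam r"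
  shows "(length (conj_part lam) = 2 \<longrightarrow>
            (\<forall>k. 0 < k \<and> k \<le> conj_part lam ! 1 \<longrightarrow>
               (garnir_quotient_iso_specht TYPE('k::field_char_0) lam [k] \<longleftrightarrow>
                  conj_part lam ! 0 > k \<or> (conj_part lam ! 0 = 1 \<and> conj_part lam ! 1 = 1 \<and> k = 1))))
       \<and> (\<forall>ks. length ks = length (conj_part lam) - 1
               \<and> (\<forall>c < length ks. 0 < ks ! c \<and> ks ! c \<le> conj_part lam ! Suc c)
               \<and> (\<forall>c < length ks. ks ! c = conj_part lam ! Suc c \<and> 1 < ks ! c
                      \<longrightarrow> conj_part lam ! c > conj_part lam ! Suc c)
             \<longrightarrow> garnir_quotient_iso_specht TYPE('k::field_char_0) lam ks)"
proof (intro conjI impI allI)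
  interpret partition_shape lam
    using assms by unfold_locales (simp add: is_partition_def)
  {
    fix k assume len: "length (conj_part lam) = 2" and k: "0 < k \<and> k \<le> conj_part lam ! 1"
    have nth: "conj_part lam ! 0 = L 0" "conj_part lam ! 1 = L 1"
      using len by (simp_all add: conj_part_nth)
    have le: "L 1 \<le> L 0" by (rule L_antimono) simp
    have c0: "Suc c < length (conj_part lam) \<longleftrightarrow> c = 0" for c using len by auto
    show "garnir_quotient_iso_specht TYPE('k) lam [k] \<longleftrightarrow>
        conj_part lam ! 0 > k \<or> (conj_part lam ! 0 = 1 \<and> conj_part lam ! 1 = 1 \<and> k = 1)"
      unfolding nth
    proof
      assume iso: "garnir_quotient_iso_specht TYPE('k) lam [k]"
      show "L 0 > k \<or> (L 0 = 1 \<and> L 1 = 1 \<and> k = 1)"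
      proof (rule ccontr)
        assume "\<not> ?thesis"
        \<comment> \<open>From k \<le> \<open>L 1\<close> \<le> \<open>L 0\<close> \<le> k all three
          are equal, and the value 1 has been excluded.\<close>
        then have "k = L 1" "L 0 = L 1" "2 \<le> L 1" using k le unfolding nth by auto
        then show False using not_iso[OF len, where 'k = 'k] iso by simp
      qed
    next
      assume "L 0 > k \<or> (L 0 = 1 \<and> L 1 = 1 \<and> k = 1)"
      then have "presenting [k]" using k unfolding nth presenting_def c0 by auto
      then show "garnir_quotient_iso_specht TYPE('k) lam [k]" by (rule presenting_imp_iso)
    qed
  next
    fix ks assume ks: "length ks = length (conj_part lam) - 1
      \<and> (\<forall>c < length ks. 0 < ks ! c \<and> ks ! c \<le> conj_part lam ! Suc c)
      \<and> (\<forall>c < length ks. ks ! c = conj_part lam ! Suc c \<and> 1 < ks ! c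
             \<longrightarrow> conj_part lam ! c > conj_part lam ! Suc c)"
    have "presenting ks"
      unfolding presenting_def
    proof (intro allI impI)
      fix c assume c: "Suc c < length (conj_part lam)"
      then have "c < length ks" using ks by simp
      moreover have "conj_part lam ! c = L c" "conj_part lam ! Suc c = L (Suc c)"
        using c by (simp_all add: conj_part_nth)
      ultimately have "0 < ks ! c" "ks ! c \<le> L (Suc c)"
        "ks ! c = L (Suc c) \<Longrightarrow> 1 < ks ! c \<Longrightarrow> L (Suc c) < L c"
        using ks by auto
      \<comment> \<open>If \<open>ks ! c\<close> reaches \<open>L c\<close>, then it also equals
        \<open>L (Suc c)\<close> and the columns are equally long, so the hypothesis leaves only the
        value 1.\<close>
      then show "0 < ks ! c \<and> ks ! c \<le> L (Suc c) \<and> (ks ! c < L c \<or> ks ! c = 1)"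
        using L_Suc_le[of c] by linarith
    qed
    then show "garnir_quotient_iso_specht TYPE('k) lam ks" by (rule presenting_imp_iso)
  }
qed

end
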